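(* The set $\mathrm{EXL}=\{e\in\mathbb N : \mathcal L_e \text{ is TxtEx-learnable}\}$, where $\mathcal L_e$ is the uniformly computably enumerable family coded by $e$, is $\Sigma^0_4$-hard: for every $\Sigma^0_4$ predicate $P$ on $\mathbb N$ there is a computable function $h:\mathbb N\to\mathbb N$ such that for all $e$, $P(e)$ holds if and only if $h(e)\in\mathrm{EXL}$.
   Context: Fix a computable pairing function $\langle\cdot,\cdot\rangle:\mathbb N^2\to\mathbb N$ and a standard numbering $W_0,W_1,\dots$ of the computably enumerable (c.e.) sets. A number $e$ codes the uniformly computably enumerable (u.c.e.) family $\mathcal L_e=\{L_0,L_1,\dots\}$ whose $i$-th member (column) is $L_i=\{x:\langle i,x\rangle\in W_e\}$; the u.c.e. families are exactly those of this form. An enumeration is a function $f:\mathbb N\to\mathbb N$; $\mathrm{content}(f)=\{x:(\exists n)\,f(n)=x\}$; $f$ is an enumeration of (for) a set $A$ if $\mathrm{content}(f)=A$. $f\upharpoonright i$ is the initial segment of $f$ of length $i$, a finite string of natural numbers. A learning machine is a (possibly partial) computable function $M$ from finite strings of natural numbers to $\mathbb N$; a statement about a value of $M$ includes that this value is defined. $M$ TxtEx-identifies an enumeration $f$ if there is $n$ such that $\lim_{i\to\infty}M(f\upharpoonright i)=n$ (i.e. $M(f\upharpoonright i)=n$ for all sufficiently large $i$) and $W_n=\mathrm{content}(f)$. $M$ TxtEx-learns a c.e. set $A$ if it TxtEx-identifies every enumeration of $A$. $M$ TxtEx-learns a family of c.e. sets if it TxtEx-learns every member of the family. A family is TxtEx-learnable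 if some learning machine TxtEx-learns it. *)

theory Defs
  imports Main "HOL-Library.Nat_Bijection"
begin

text \<open>
  The partial computable functions in one argument, tuples being coded by the Cantor pairing
  function \<^const>\<open>prod_encode\<close>. The identity is \<open>Pairing Proj1 Proj2\<close>, since the coding is bijective.
\<close>

abbreviation pair :: "nat \<Rightarrow> nat \<Rightarrow> nat" where
  "pair a b \<equiv> prod_encode (a, b)"

datatype recf =
    Zero
  | Succ
  | Proj1
  | Proj2
  | Pairing recf recf
  | Comp recf recf
  | PrimRec recf recf
  | Mu recf

text \<open>
  \<^term>\<open>PrimRec f g\<close> maps \<open>pair x 0\<close> to \<open>f x\<close> and \<open>pair x (Suc m)\<close> to
  \<open>g (pair x (pair m v))\<close>, where \<open>v\<close> is the value at \<open>pair x m\<close>.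
  \<^term>\<open>Mu f\<close> maps \<open>x\<close> to the least zero \<open>n\<close> of \<open>f (pair x n)\<close>, provided that \<open>f\<close> is defined
  at \<open>pair x m\<close> for all \<open>m < n\<close>. The value \<^const>\<open>None\<close> means divergence.
\<close>

primrec eval :: "recf \<Rightarrow> nat \<Rightarrow> nat option" where
  "eval Zero x = Some 0"
| "eval Succ x = Some (Suc x)"
| "eval Proj1 x = Some (fst (prod_decode x))"
| "eval Proj2 x = Some (snd (prod_decode x))"
| "eval (Pairing f g) x =
     Option.bind (eval f x) (\<lambda>a. Option.bind (eval g x) (\<lambda>b. Some (pair a b)))"
| "eval (Comp f g) x = Option.bind (eval g x) (eval f)"
| "eval (PrimRec f g) x =
     rec_nat (eval f (fst (prod_decode x)))
       (\<lambda>m r. Option.bind r (\<lambda>v. eval g (pair (fst (prod_decode x)) (pair m v))))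
       (snd (prod_decode x))"
| "eval (Mu f) x =
     (if \<exists>n. eval f (pair x n) = Some 0 \<and> (\<forall>m<n. eval f (pair x m) \<noteq> None)
      then Some (LEAST n. eval f (pair x n) = Some 0) else None)"

definition partial_computable :: "(nat \<Rightarrow> nat option) \<Rightarrow> bool" where
  "partial_computable f \<longleftrightarrow> (\<exists>p. eval p = f)"

definition computable :: "(nat \<Rightarrow> nat) \<Rightarrow> bool" where
  "computable f \<longleftrightarrow> partial_computable (\<lambda>x. Some (f x))"

definition decidable :: "(nat \<Rightarrow> bool) \<Rightarrow> bool" where
  "decidable P \<longleftrightarrow> computable (\<lambda>x. if P x then 1 else 0)"

function program :: "nat \<Rightarrow> recf" where
  "program e =
    (if e = 0 then Zero
     else if e = 1 then Succ
     else if e = 2 then Proj1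
     else if e = 3 then Proj2
     else
       (let k = (e - 4) div 4; a = fst (prod_decode k); b = snd (prod_decode k) in
        if e mod 4 = 0 then Pairing (program a) (program b)
        else if e mod 4 = 1 then Comp (program a) (program b)
        else if e mod 4 = 2 then PrimRec (program a) (program b)
        else Mu (program k)))"
  by pat_completeness auto
termination
proof -
  have le: "fst (prod_decode k) \<le> k" "snd (prod_decode k) \<le> k" for k
    using le_prod_encode_1[of "fst (prod_decode k)" "snd (prod_decode k)"]
      le_prod_encode_2[of "snd (prod_decode k)" "fst (prod_decode k)"] by simp_all
  have lt: "(e - 4) div 4 < e" if "e \<noteq> 0" for e :: nat
    using that by linarith
  show ?thesis
    by (relation "Wellfounded.measure id")
      (auto intro: le_less_trans[OF le(1) lt] le_less_trans[OF le(2) lt] lt)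
qed

declare program.simps [simp del]

primrec program_code :: "recf \<Rightarrow> nat" where
  "program_code Zero = 0"
| "program_code Succ = 1"
| "program_code Proj1 = 2"
| "program_code Proj2 = 3"
| "program_code (Pairing f g) = 4 * pair (program_code f) (program_code g) + 4"
| "program_code (Comp f g) = 4 * pair (program_code f) (program_code g) + 5"
| "program_code (PrimRec f g) = 4 * pair (program_code f) (program_code g) + 6"
| "program_code (Mu f) = 4 * program_code f + 7"

lemma program_program_code: "program (program_code p) = p"
proof -
  have "Suc (4 * k) div 4 = k" "(4 * k + 2) div 4 = k" "(4 * k + 3) div 4 = k"
    "Suc (Suc (4 * k)) div 4 = k" "Suc (Suc (Suc (4 * k))) div 4 = k"
    "(4 * k + 4) mod 4 = 0" "(4 * k + 5) mod 4 = 1" "(4 * k + 6) mod 4 = 2"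
    "(4 * k + 7) mod 4 = 3" for k :: nat
    by presburger+
  then show ?thesis
    by (induction p) (subst program.simps; simp add: Let_def)+
qed

definition W :: "nat \<Rightarrow> nat set" where
  "W e = {x. eval (program e) x \<noteq> None}"

fun Sigma0 :: "nat \<Rightarrow> (nat \<Rightarrow> bool) \<Rightarrow> bool"
  and Pi0 :: "nat \<Rightarrow> (nat \<Rightarrow> bool) \<Rightarrow> bool" where
  "Sigma0 0 P \<longleftrightarrow> decidable P"
| "Sigma0 (Suc n) P \<longleftrightarrow> (\<exists>Q. Pi0 n Q \<and> (\<forall>x. P x \<longleftrightarrow> (\<exists>y. Q (pair x y))))"
| "Pi0 0 P \<longleftrightarrow> decidable P"
| "Pi0 (Suc n) P \<longleftrightarrow> (\<exists>Q. Sigma0 n Q \<and> (\<forall>x. P x \<longleftrightarrow> (\<forall>y. Q (pair x y))))"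

definition Sigma0_hard :: "nat \<Rightarrow> nat set \<Rightarrow> bool" where
  "Sigma0_hard n A \<longleftrightarrow>
     (\<forall>P. Sigma0 n P \<longrightarrow> (\<exists>h. computable h \<and> (\<forall>e. P e \<longleftrightarrow> h e \<in> A)))"

definition column :: "nat \<Rightarrow> nat \<Rightarrow> nat set" where
  "column e i = {x. pair i x \<in> W e}"

definition uce_family :: "nat \<Rightarrow> nat set set" where
  "uce_family e = range (column e)"

definition enumeration_of :: "(nat \<Rightarrow> nat) \<Rightarrow> nat set \<Rightarrow> bool" where
  "enumeration_of f A \<longleftrightarrow> range f = A"

definition initial_segment :: "(nat \<Rightarrow> nat) \<Rightarrow> nat \<Rightarrow> nat list" where
  "initial_segment f i = map f [0..<i]"

text \<open>
  Strings are coded by the library's computable bijection between lists of numbers and numbers.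
\<close>

definition learning_machine :: "(nat list \<Rightarrow> nat option) \<Rightarrow> bool" where
  "learning_machine M \<longleftrightarrow> partial_computable (\<lambda>x. M (list_decode x))"

definition TxtEx_identifies :: "(nat list \<Rightarrow> nat option) \<Rightarrow> (nat \<Rightarrow> nat) \<Rightarrow> bool" where
  "TxtEx_identifies M f \<longleftrightarrow>
     (\<exists>n. (\<exists>k. \<forall>i\<ge>k. M (initial_segment f i) = Some n) \<and> W n = range f)"

text \<open>The empty set has no enumeration, so it is learned by every machine.\<close>

definition TxtEx_learns :: "(nat list \<Rightarrow> nat option) \<Rightarrow> nat set \<Rightarrow> bool" where
  "TxtEx_learns M A \<longleftrightarrow> (\<forall>f. enumeration_of f A \<longrightarrow> TxtEx_identifies M f)"

definition TxtEx_learns_family :: "(nat list \<Rightarrow> nat option) \<Rightarrow> nat set set \<Rightarrow> bool" where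
  "TxtEx_learns_family M F \<longleftrightarrow> (\<forall>A\<in>F. TxtEx_learns M A)"

definition TxtEx_learnable :: "nat set set \<Rightarrow> bool" where
  "TxtEx_learnable F \<longleftrightarrow> (\<exists>M. learning_machine M \<and> TxtEx_learns_family M F)"

definition EXL :: "nat set" where
  "EXL = {e. TxtEx_learnable (uce_family e)}"

end

theory Submission imports Defs begin

text \<open>
  Write \<open>P e\<close> as: only finitely many \<open>i = (n, w)\<close> satisfy a \<open>\<Pi>\<^sub>2\<close> condition \<open>\<forall>c. \<exists>d. A e i c d\<close>,
  where moreover, if \<open>P e\<close> fails, then each \<open>n\<close> occurs in such a pair. The family consists of the
  sets \<open>N\<^sub>i = {i} \<times> \<nat>\<close> and of initial segments \<open>T\<^sub>i\<close> of them. The set \<open>T\<^sub>i\<close> gets its element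
  number \<open>v\<close> once \<open>\<exists>d. A e i c d\<close> has been verified for all \<open>c \<le> v\<close> and no string with code below
  \<open>v\<close> looks like a locking sequence of the \<open>n\<close>-th machine on \<open>N\<^sub>i\<close>.

  If the condition holds for \<open>i\<close>, then the \<open>n\<close>-th machine fails: either it has no locking sequence
  on \<open>N\<^sub>i\<close>, or \<open>T\<^sub>i\<close> is a finite set that contains a locking sequence for \<open>N\<^sub>i\<close>. So the family is
  not learnable if \<open>P e\<close> fails. If \<open>P e\<close> holds, then all but finitely many \<open>T\<^sub>i\<close> are finite, and
  \<open>T\<^sub>i = N\<^sub>i\<close> for the exceptions. For finite \<open>T\<^sub>i\<close> a learner guesses \<open>T\<^sub>i\<close> as long as the data lie
  in the current stage of \<open>T\<^sub>i\<close>, and \<open>N\<^sub>i\<close> otherwise.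
\<close>

section \<open>Closure properties of computable functions\<close>

abbreviation p1 :: "nat \<Rightarrow> nat" where "p1 z \<equiv> fst (prod_decode z)"
abbreviation p2 :: "nat \<Rightarrow> nat" where "p2 z \<equiv> snd (prod_decode z)"

named_theorems comp_intros

lemma computableI: "(\<And>x. eval p x = Some (f x)) \<Longrightarrow> computable f"
  unfolding computable_def partial_computable_def by blast

lemma computableE:
  assumes "computable f"
  obtains p where "\<And>x. eval p x = Some (f x)"
  using assms unfolding computable_def partial_computable_def by metis

lemma computable_id [comp_intros]: "computable (\<lambda>x. x)"
  by (rule computableI[of "Pairing Proj1 Proj2"]) simp

primrec const_recf :: "nat \<Rightarrow> recf" where
  "const_recf 0 = Zero"
| "const_recf (Suc k) = Comp Succ (const_recf k)"

lemma eval_const_recf [simp]: "eval (const_recf k) x = Some k"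
  by (induction k) auto

lemma computable_const [comp_intros]: "computable (\<lambda>x. k)"
  by (rule computableI[of "const_recf k"]) simp

lemma computable_compose:
  assumes "computable f" "computable g"
  shows "computable (\<lambda>x. f (g x))"
proof -
  obtain p q where "\<And>x. eval p x = Some (f x)" "\<And>x. eval q x = Some (g x)"
    using assms by (metis computableE)
  then show ?thesis
    by (intro computableI[of "Comp p q"]) simp
qed

lemma computable_Suc [comp_intros]: "computable f \<Longrightarrow> computable (\<lambda>x. Suc (f x))"
  by (rule computable_compose[of Suc]) (auto intro: computableI[of Succ])

lemma computable_p1 [comp_intros]: "computable f \<Longrightarrow> computable (\<lambda>x. p1 (f x))"
  by (rule computable_compose[of p1]) (auto intro: computableI[of Proj1])

lemma computable_p2 [comp_intros]: "computable f \<Longrightarrow> computable (\<lambda>x. p2 (f x))"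
  by (rule computable_compose[of p2]) (auto intro: computableI[of Proj2])

lemma computable_pair [comp_intros]:
  assumes "computable f" "computable g"
  shows "computable (\<lambda>x. pair (f x) (g x))"
proof -
  obtain p q where "\<And>x. eval p x = Some (f x)" "\<And>x. eval q x = Some (g x)"
    using assms by (metis computableE)
  then show ?thesis
    by (intro computableI[of "Pairing p q"]) simp
qed

text \<open>Multi-argument functions are given on coded pairs; this rule instantiates such a
  hypothesis at the nested projections that arise under a recursion.\<close>

lemma computable_compose2:
  assumes "computable (\<lambda>z. f (p1 z) (p2 z))" "computable g" "computable h"
  shows "computable (\<lambda>x. f (g x) (h x))"
  using computable_compose[OF assms(1) computable_pair[OF assms(2,3)]] by simp

lemma computable_rec_nat [comp_intros]:
  assumes "computable f" "computable (\<lambda>z. g (p1 z) (p1 (p2 z)) (p2 (p2 z)))" "computable h"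
  shows "computable (\<lambda>x. rec_nat (f x) (g x) (h x))"
proof -
  obtain p q where p: "\<And>x. eval p x = Some (f x)"
    and q: "\<And>z. eval q z = Some (g (p1 z) (p1 (p2 z)) (p2 (p2 z)))"
    using assms(1,2) by (metis (no_types, lifting) computableE)
  have "rec_nat (eval p x) (\<lambda>m r. Option.bind r (\<lambda>v. eval q (pair x (pair m v)))) n
      = Some (rec_nat (f x) (g x) n)" for x n
    by (induction n) (simp_all add: p q)
  then have "computable (\<lambda>z. rec_nat (f (p1 z)) (g (p1 z)) (p2 z))"
    by (intro computableI[of "PrimRec p q"]) simp
  from computable_compose[OF this computable_pair[OF computable_id assms(3)]]
  show ?thesis by simp
qed

lemma computable_funpow [comp_intros]:
  assumes "computable (\<lambda>z. g (p1 z) (p2 z))" "computable f" "computable h"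
  shows "computable (\<lambda>x. (g x ^^ h x) (f x))"
proof -
  have "(g x ^^ n) y = rec_nat y (\<lambda>_. g x) n" for x y n
    by (induction n) auto
  moreover have "computable (\<lambda>x. rec_nat (f x) (\<lambda>_. g x) (h x))"
    by (intro comp_intros assms(2,3) computable_compose2[OF assms(1)])
  ultimately show ?thesis by (simp only:)
qed

lemma computable_pred [comp_intros]:
  assumes "computable f"
  shows "computable (\<lambda>x. f x - Suc 0)"
proof -
  have "n - Suc 0 = rec_nat 0 (\<lambda>m v. m) n" for n
    by (cases n) auto
  then show ?thesis
    by (simp only:) (intro comp_intros assms)
qed

lemma computable_add [comp_intros]:
  assumes "computable f" "computable g"
  shows "computable (\<lambda>x. f x + g x)"
proof -
  have "m + n = rec_nat m (\<lambda>_ v. Suc v) n" for m n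
    by (induction n) auto
  then show ?thesis
    by (simp only:) (intro comp_intros assms)
qed

lemma computable_mult [comp_intros]:
  assumes "computable f" "computable g"
  shows "computable (\<lambda>x. f x * g x)"
proof -
  have "m * n = rec_nat 0 (\<lambda>_ v. v + m) n" for m n :: nat
    by (induction n) auto
  then show ?thesis
    by (simp only:) (intro comp_intros computable_compose[OF assms(1)] assms(2))
qed

lemma computable_power [comp_intros]:
  assumes "computable f" "computable g"
  shows "computable (\<lambda>x. f x ^ g x)"
proof -
  have "m ^ n = rec_nat 1 (\<lambda>_ v. v * m) n" for m n :: nat
    by (induction n) auto
  then show ?thesis
    by (simp only:) (intro comp_intros computable_compose[OF assms(1)] assms(2))
qed

lemma computable_diff [comp_intros]:
  assumes "computable f" "computable g"
  shows "computable (\<lambda>x. f x - g x)"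
proof -
  have "m - n = rec_nat m (\<lambda>_ v. v - Suc 0) n" for m n :: nat
    by (induction n) auto
  \<comment> \<open>Used as a rewrite rule, the recursion equation would loop on the difference
    \<open>v - Suc 0\<close> in its right-hand side.\<close>
  then have "(\<lambda>x. f x - g x) = (\<lambda>x. rec_nat (f x) (\<lambda>_ v. v - Suc 0) (g x))"
    by blast
  moreover have "computable \<dots>"
    by (intro comp_intros assms)
  ultimately show ?thesis by (simp only:)
qed

lemma computable_if [comp_intros]:
  assumes "decidable P" "computable f" "computable g"
  shows "computable (\<lambda>x. if P x then f x else g x)"
proof -
  have "(\<lambda>x. if P x then f x else g x)
      = (\<lambda>x. rec_nat (g x) (\<lambda>_ _. f x) (if P x then 1 else 0))"
    by auto
  moreover have "computable \<dots>"
    using assms(1)[unfolded decidable_def]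
    by (intro comp_intros computable_compose[OF assms(2)] assms(3))
  ultimately show ?thesis by (simp only:)
qed

section \<open>Boolean connectives, comparisons, bounded quantifiers and searches\<close>

lemma decidable_compose:
  "decidable P \<Longrightarrow> computable f \<Longrightarrow> decidable (\<lambda>x. P (f x))"
  unfolding decidable_def by (rule computable_compose)

lemma decidable_compose2:
  assumes "decidable (\<lambda>z. P (p1 z) (p2 z))" "computable f" "computable g"
  shows "decidable (\<lambda>x. P (f x) (g x))"
  using decidable_compose[OF assms(1) computable_pair[OF assms(2,3)]] by simp

lemma decidable_const [comp_intros]: "decidable (\<lambda>x. b)"
  unfolding decidable_def by (rule computable_const)

lemma decidable_eq_0:
  assumes "computable f"
  shows "decidable (\<lambda>x. f x = 0)"
proof -
  have "(\<lambda>x. if f x = 0 then 1 else 0) = (\<lambda>x. 1 - f x)"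
    by auto
  then show ?thesis
    unfolding decidable_def by (simp only:) (intro comp_intros assms)
qed

lemma decidable_not [comp_intros]:
  assumes "decidable P"
  shows "decidable (\<lambda>x. \<not> P x)"
proof -
  have "computable (\<lambda>x. if P x then 0 else 1)"
    by (intro comp_intros assms)
  moreover have "(\<lambda>x. if P x then 0 else 1) = (\<lambda>x. if \<not> P x then 1 else (0::nat))"
    by auto
  ultimately show ?thesis
    unfolding decidable_def by (simp only:)
qed

lemma decidable_conj [comp_intros]:
  assumes "decidable P" "decidable Q"
  shows "decidable (\<lambda>x. P x \<and> Q x)"
proof -
  have "computable (\<lambda>x. if P x then (if Q x then 1 else 0) else 0)"
    by (intro comp_intros assms)
  moreover have "(\<lambda>x. if P x then (if Q x then 1 else 0) else 0)
      = (\<lambda>x. if P x \<and> Q x then 1 else (0::nat))"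
    by auto
  ultimately show ?thesis
    unfolding decidable_def by (simp only:)
qed

lemma decidable_disj [comp_intros]:
  assumes "decidable P" "decidable Q"
  shows "decidable (\<lambda>x. P x \<or> Q x)"
proof -
  have "decidable (\<lambda>x. \<not> (\<not> P x \<and> \<not> Q x))"
    by (intro comp_intros assms)
  then show ?thesis by simp
qed

lemma decidable_imp [comp_intros]:
  assumes "decidable P" "decidable Q"
  shows "decidable (\<lambda>x. P x \<longrightarrow> Q x)"
proof -
  have "decidable (\<lambda>x. \<not> P x \<or> Q x)"
    by (intro comp_intros assms)
  then show ?thesis by (simp only: imp_conv_disj)
qed

lemma decidable_le [comp_intros]:
  assumes "computable f" "computable g"
  shows "decidable (\<lambda>x. f x \<le> g x)"
  using decidable_eq_0[OF computable_diff[OF assms]] by simp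

lemma decidable_less [comp_intros]:
  assumes "computable f" "computable g"
  shows "decidable (\<lambda>x. f x < g x)"
  using decidable_le[OF computable_Suc[OF assms(1)] assms(2)] by (simp add: Suc_le_eq)

lemma decidable_eq [comp_intros]:
  assumes "computable f" "computable g"
  shows "decidable (\<lambda>x. f x = g x)"
proof -
  have "(\<lambda>x. f x = g x) = (\<lambda>x. f x \<le> g x \<and> g x \<le> f x)"
    by auto
  moreover have "decidable \<dots>"
    by (intro comp_intros assms)
  ultimately show ?thesis by (simp only:)
qed

lemma decidable_ex_less [comp_intros]:
  assumes "decidable (\<lambda>z. P (p1 z) (p2 z))" "computable f"
  shows "decidable (\<lambda>x. \<exists>k<f x. P x k)"
proof -
  have eq: "(if \<exists>k<n. P x k then 1 else 0)
      = rec_nat (0::nat) (\<lambda>k v. if P x k then 1 else v) n" for x n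
  proof (induction n)
    case (Suc n)
    then show ?case
      by (cases "P x n") (auto simp: less_Suc_eq simp flip: Suc.IH)
  qed simp
  have "computable (\<lambda>x. rec_nat 0 (\<lambda>k v. if P x k then 1 else v) (f x))"
    by (intro comp_intros decidable_compose2[OF assms(1)] assms(2))
  then show ?thesis
    unfolding decidable_def eq .
qed

lemma decidable_all_less [comp_intros]:
  assumes "decidable (\<lambda>z. P (p1 z) (p2 z))" "computable f"
  shows "decidable (\<lambda>x. \<forall>k<f x. P x k)"
proof -
  have "decidable (\<lambda>x. \<not> (\<exists>k<f x. \<not> P x k))"
    by (intro comp_intros decidable_compose2[OF assms(1)] assms(2))
  then show ?thesis by simp
qed

lemma computable_Least [comp_intros]:
  assumes "decidable (\<lambda>z. R (p1 z) (p2 z))" "\<And>x. \<exists>n. R x n"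
  shows "computable (\<lambda>x. LEAST n. R x n)"
proof -
  have "computable (\<lambda>z. if R (p1 z) (p2 z) then 0 else 1)"
    by (intro comp_intros assms)
  from computableE[OF this] obtain p
    where "\<And>z. eval p z = Some (if R (p1 z) (p2 z) then 0 else 1)"
    by blast
  then show ?thesis
    using assms(2) by (intro computableI[of "Mu p"]) simp
qed

text \<open>Division is handled this way: its graph is decidable by inequalities, and a search over
  the graph finds the value.\<close>

lemma computable_graph:
  assumes "decidable (\<lambda>z. p2 z = f (p1 z))"
  shows "computable f"
proof -
  have "computable (\<lambda>x. LEAST n. n = f x)"
    by (intro comp_intros assms) simp
  moreover have "(LEAST n. n = f x) = f x" for x
    by (rule Least_equality) auto
  ultimately show ?thesis by (simp only:)
qed

lemma computable_div [comp_intros]: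
  assumes "computable f" "computable g"
  shows "computable (\<lambda>x. f x div g x)"
proof -
  have "q = m div n \<longleftrightarrow> n = 0 \<and> q = 0 \<or> n \<noteq> 0 \<and> n * q \<le> m \<and> m < n * Suc q" for q m n :: nat
    by (cases "n = 0")
      (auto simp: div_nat_eqI dividend_less_times_div mult.commute)
  then have "decidable (\<lambda>z. p2 z = p1 (p1 z) div p2 (p1 z))"
    by (simp only:) (intro comp_intros)
  then have "computable (\<lambda>z. p1 z div p2 z)"
    by (rule computable_graph)
  from computable_compose2[OF this assms] show ?thesis .
qed

lemma decidable_even [comp_intros]:
  assumes "computable f"
  shows "decidable (\<lambda>x. even (f x))"
proof -
  have "even n \<longleftrightarrow> 2 * (n div 2) = n" for n :: nat
    by (metis dvd_mult_div_cancel dvd_triv_left)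
  then show ?thesis
    by (simp only:) (intro comp_intros assms)
qed

section \<open>Indices of computably enumerable sets\<close>

lemma W_program_code: "W (program_code p) = {x. eval p x \<noteq> None}"
  by (simp add: W_def program_program_code)

text \<open>An s-m-n theorem: program \<open>g k\<close> forms \<open>pair k x\<close> from a
  built-in constant \<open>k\<close> and then searches for \<open>s\<close>.\<close>

lemma smn_ce:
  assumes "decidable R"
  obtains g where "computable g" "\<And>k. W (g k) = {x. \<exists>s. R (pair (pair k x) s)}"
proof -
  have "computable (\<lambda>z. if R z then 0 else 1)"
    by (intro comp_intros assms)
  from computableE[OF this] obtain q where q: "\<And>z. eval q z = Some (if R z then 0 else 1)"
    by blast
  define g where "g k = program_code (Comp (Mu q) (Pairing (const_recf k) (Pairing Proj1 Proj2)))"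
    for k
  \<comment> \<open>Composing with \<open>Succ\<close> acts on codes as
    \<open>4 * pair 1 v + 5\<close>, because \<open>Succ\<close> has code 1.\<close>
  have "program_code (const_recf k) = rec_nat 0 (\<lambda>_ v. 4 * pair 1 v + 5) k" for k
    by (induction k) auto
  then have "computable g"
    unfolding g_def by (simp only: program_code.simps) (intro comp_intros)
  moreover have "W (g k) = {x. \<exists>s. R (pair (pair k x) s)}" for k
    unfolding g_def W_program_code by (auto simp: q)
  ultimately show thesis ..
qed

section \<open>Certificates of computations\<close>

abbreviation triple :: "nat \<Rightarrow> nat \<Rightarrow> nat \<Rightarrow> nat" where
  "triple c x y \<equiv> pair c (pair x y)"

lemma decidable_mem_set_decode [comp_intros]:
  assumes "computable f" "computable g"
  shows "decidable (\<lambda>x. f x \<in> set_decode (g x))"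
  unfolding set_decode_def mem_Collect_eq by (intro comp_intros assms)

text \<open>Bounds quantifiers over members of a coded finite set by the code, which makes
  certificates decidable.\<close>

lemma mem_set_decode_less: "k \<in> set_decode D \<Longrightarrow> k < D"
proof -
  assume "k \<in> set_decode D"
  then have "set_decode (2 ^ k) \<subseteq> set_decode D"
    using set_decode_plus_power_2[of k 0] by simp
  then have "2 ^ k \<le> D"
    by (rule subset_decode_imp_le)
  then show ?thesis
    using less_exp[of k] by linarith
qed

lemma triple_less:
  assumes "triple c x y \<in> set_decode D"
  shows "c < D" "x < D" "y < D"
proof -
  have "triple c x y < D"
    using assms by (rule mem_set_decode_less)
  moreover have "c \<le> triple c x y" "x \<le> pair x y" "y \<le> pair x y" "pair x y \<le> triple c x y"
    by (simp_all add: le_prod_encode_1 le_prod_encode_2)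
  ultimately show "c < D" "x < D" "y < D"
    by linarith+
qed

text \<open>
  A triple \<open>(c, x, y)\<close> asserts that program \<open>c\<close> maps \<open>x\<close> to \<open>y\<close>. A set of triples in which each
  one follows from others by a clause of \<^const>\<open>eval\<close> contains true assertions only, since the
  clauses decrease \<open>(c, x)\<close> lexicographically. The finite sets of this kind are the certificates
  of computations.
\<close>

definition justified_in :: "nat set \<Rightarrow> nat \<Rightarrow> nat \<Rightarrow> nat \<Rightarrow> bool" where
  "justified_in S c x y \<longleftrightarrow>
     c = 0 \<and> y = 0 \<or> c = 1 \<and> y = Suc x \<or> c = 2 \<and> y = p1 x \<or> c = 3 \<and> y = p2 x \<or>
     (\<exists>a<c. \<exists>b<c.
        c = 4 * pair a b + 4 \<and> triple a x (p1 y) \<in> S \<and> triple b x (p2 y) \<in> S \<or>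
        c = 4 * pair a b + 5 \<and> (\<exists>z. triple b x z \<in> S \<and> triple a z y \<in> S) \<or>
        c = 4 * pair a b + 6 \<and> p2 x = 0 \<and> triple a (p1 x) y \<in> S \<or>
        c = 4 * pair a b + 6 \<and> (\<exists>m<p2 x. p2 x = Suc m \<and>
          (\<exists>v. triple c (pair (p1 x) m) v \<in> S \<and> triple b (pair (p1 x) (pair m v)) y \<in> S)) \<or>
        c = 4 * a + 7 \<and> triple a (pair x y) 0 \<in> S \<and>
          (\<forall>m<y. \<exists>v. triple a (pair x m) (Suc v) \<in> S))"

definition certificate :: "nat set \<Rightarrow> bool" where
  "certificate S \<longleftrightarrow> (\<forall>w\<in>S. justified_in S (p1 w) (p1 (p2 w)) (p2 (p2 w)))"

lemma certificateD: "certificate S \<Longrightarrow> triple c x y \<in> S \<Longrightarrow> justified_in S c x y"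
  unfolding certificate_def by fastforce

text \<open>Every clause mentions \<open>S\<close> only positively.\<close>

lemma justified_in_mono: "S \<subseteq> T \<Longrightarrow> justified_in S c x y \<Longrightarrow> justified_in T c x y"
  unfolding justified_in_def
  by (elim disj_forward conj_forward ex_forward all_forward imp_forward;
      (assumption | erule (1) subsetD))

lemma certificate_Union: "(\<And>S. S \<in> \<S> \<Longrightarrow> certificate S) \<Longrightarrow> certificate (\<Union>\<S>)"
  unfolding certificate_def by (blast intro: justified_in_mono[OF Union_upper])

lemma certificate_insert:
  "certificate S \<Longrightarrow> justified_in S c x y \<Longrightarrow> certificate (insert (triple c x y) S)"
  unfolding certificate_def by (auto intro: justified_in_mono[OF subset_insertI])

definition certified :: "nat \<Rightarrow> nat \<Rightarrow> nat \<Rightarrow> bool" where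
  "certified c x y \<longleftrightarrow> (\<exists>S. finite S \<and> certificate S \<and> triple c x y \<in> S)"

text \<open>The union of certificates for the finitely many premises is a certificate, and the
  conclusion can be added to it.\<close>

lemma certified_step:
  assumes "finite F" "\<And>c x y. triple c x y \<in> F \<Longrightarrow> certified c x y" "justified_in F c x y"
  shows "certified c x y"
proof -
  have "\<forall>w\<in>F. \<exists>S. finite S \<and> certificate S \<and> w \<in> S"
  proof
    fix w
    assume "w \<in> F"
    then show "\<exists>S. finite S \<and> certificate S \<and> w \<in> S"
      using assms(2)[of "p1 w" "p1 (p2 w)" "p2 (p2 w)"] by (simp add: certified_def)
  qed
  from bchoice[OF this] obtain S
    where S: "\<forall>w\<in>F. finite (S w) \<and> certificate (S w) \<and> w \<in> S w" ..
  define T where "T = \<Union>(S ` F)"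
  have T: "certificate T" "finite T" "F \<subseteq> T"
    unfolding T_def
    subgoal by (rule certificate_Union) (use S in auto)
    subgoal by (rule finite_UN_I) (use S assms(1) in auto)
    subgoal using S by auto
    done
  have "certificate (insert (triple c x y) T)"
    using T(1) justified_in_mono[OF T(3) assms(3)] by (rule certificate_insert)
  moreover have "finite (insert (triple c x y) T)" "triple c x y \<in> insert (triple c x y) T"
    using T(2) by simp_all
  ultimately show ?thesis
    unfolding certified_def by (intro exI conjI)
qed

lemma certified_base: "justified_in {} c x y \<Longrightarrow> certified c x y"
  by (rule certified_step[of "{}"]) simp_all

lemma decidable_certificate [comp_intros]:
  assumes "computable f"
  shows "decidable (\<lambda>x. certificate (set_decode (f x)))"
proof -
  have justified: "justified_in (set_decode D) c x y \<longleftrightarrow>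
     c = 0 \<and> y = 0 \<or> c = 1 \<and> y = Suc x \<or> c = 2 \<and> y = p1 x \<or> c = 3 \<and> y = p2 x \<or>
     (\<exists>a<c. \<exists>b<c.
        c = 4 * pair a b + 4 \<and> triple a x (p1 y) \<in> set_decode D \<and>
          triple b x (p2 y) \<in> set_decode D \<or>
        c = 4 * pair a b + 5 \<and>
          (\<exists>z<D. triple b x z \<in> set_decode D \<and> triple a z y \<in> set_decode D) \<or>
        c = 4 * pair a b + 6 \<and> p2 x = 0 \<and> triple a (p1 x) y \<in> set_decode D \<or>
        c = 4 * pair a b + 6 \<and> (\<exists>m<p2 x. p2 x = Suc m \<and>
          (\<exists>v<D. triple c (pair (p1 x) m) v \<in> set_decode D \<and>
            triple b (pair (p1 x) (pair m v)) y \<in> set_decode D)) \<or>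
        c = 4 * a + 7 \<and> triple a (pair x y) 0 \<in> set_decode D \<and>
          (\<forall>m<y. \<exists>v<D. triple a (pair x m) (Suc v) \<in> set_decode D))" for D c x y
  proof -
    \<comment> \<open>The values occur in members of \<open>set_decode D\<close>, hence lie below
      \<open>D\<close>.\<close>
    have 1: "(\<exists>z. triple b x z \<in> set_decode D \<and> Q z) \<longleftrightarrow>
        (\<exists>z<D. triple b x z \<in> set_decode D \<and> Q z)" for b x Q
      by (intro ex_cong1) (auto dest: triple_less(3))
    have 2: "(\<exists>z. triple b x (Suc z) \<in> set_decode D) \<longleftrightarrow>
        (\<exists>z<D. triple b x (Suc z) \<in> set_decode D)" for b x
      by (intro ex_cong1) (auto dest: triple_less(3))
    show ?thesis
      unfolding justified_in_def 1 2 ..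
  qed
  have "certificate (set_decode D) \<longleftrightarrow> (\<forall>w<D. w \<in> set_decode D \<longrightarrow>
      justified_in (set_decode D) (p1 w) (p1 (p2 w)) (p2 (p2 w)))" for D
    unfolding certificate_def using mem_set_decode_less by blast
  then show ?thesis
    unfolding justified by (simp only:) (intro comp_intros computable_compose[OF assms])
qed

section \<open>Soundness of certificates\<close>

lemma program_shapes:
  "program (4 * pair a b + 4) = Pairing (program a) (program b)"
  "program (4 * pair a b + 5) = Comp (program a) (program b)"
  "program (4 * pair a b + 6) = PrimRec (program a) (program b)"
  "program (4 * a + 7) = Mu (program a)"
proof -
  have eqs: "Suc (4 * k) div 4 = k" "(4 * k + 2) div 4 = k" "(4 * k + 3) div 4 = k"
    "Suc (Suc (4 * k)) div 4 = k" "Suc (Suc (Suc (4 * k))) div 4 = k"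
    "(4 * k + 4) mod 4 = 0" "(4 * k + 5) mod 4 = 1" "(4 * k + 6) mod 4 = 2"
    "(4 * k + 7) mod 4 = 3" for k :: nat
    by presburger+
  show "program (4 * pair a b + 4) = Pairing (program a) (program b)"
    by (subst program.simps) (simp add: Let_def eqs)
  show "program (4 * pair a b + 5) = Comp (program a) (program b)"
    by (subst program.simps) (simp add: Let_def eqs)
  show "program (4 * pair a b + 6) = PrimRec (program a) (program b)"
    by (subst program.simps) (simp add: Let_def eqs)
  show "program (4 * a + 7) = Mu (program a)"
    by (subst program.simps) (simp add: Let_def eqs)
qed

lemma certificate_sound:
  assumes "certificate S"
  shows "triple c x y \<in> S \<Longrightarrow> eval (program c) x = Some y"
proof (induction c arbitrary: x y rule: less_induct)
  case (less c)
  from certificateD[OF assms less.prems] have "justified_in S c x y" .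
  then consider
      "c = 0" "y = 0" | "c = 1" "y = Suc x" | "c = 2" "y = p1 x" | "c = 3" "y = p2 x"
    | (Pairing) a b where "a < c" "b < c" "c = 4 * pair a b + 4"
        "triple a x (p1 y) \<in> S" "triple b x (p2 y) \<in> S"
    | (Comp) a b z where "a < c" "b < c" "c = 4 * pair a b + 5"
        "triple b x z \<in> S" "triple a z y \<in> S"
    | (PrimRec) a b where "a < c" "b < c" "c = 4 * pair a b + 6"
    | (Mu) a where "a < c" "c = 4 * a + 7"
        "triple a (pair x y) 0 \<in> S" "\<forall>m<y. \<exists>v. triple a (pair x m) (Suc v) \<in> S"
    unfolding justified_in_def by blast
  then show ?case
  proof cases
    case Pairing
    then show ?thesis
      using less.IH[of a x] less.IH[of b x] by (simp add: program_shapes)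
  next
    case Comp
    then show ?thesis
      using less.IH[of b x] less.IH[of a z] by (simp add: program_shapes)
  next
    case (PrimRec a b)
    \<comment> \<open>Another triple for the same \<open>c\<close> might be justified through other
      components or another clause; the coding excludes both.\<close>
    have shape: "a' = a \<and> b' = b" if "c = 4 * pair a' b' + 6" for a' b'
      using that PrimRec(3) by (simp add: prod_encode_eq)
    have not_shape: "c \<noteq> 0" "c \<noteq> 1" "c \<noteq> 2" "c \<noteq> 3" "c \<noteq> 4 * pair a' b' + 4"
        "c \<noteq> 4 * pair a' b' + 5" "c \<noteq> 4 * a' + 7" for a' b'
      using PrimRec(3) by presburger+
    \<comment> \<open>The successor clause refers back to the same \<open>c\<close>, so an inner
      induction on the counter joins the outer one on \<open>c\<close>.\<close>
    have "triple c (pair u n) w \<in> S \<Longrightarrow> eval (program c) (pair u n) = Some w" for u n w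
    proof (induction n arbitrary: w)
      case 0
      from certificateD[OF assms this] have "triple a u w \<in> S"
        unfolding justified_in_def using not_shape shape by auto
      then show ?case
        using less.IH[of a] PrimRec by (simp add: program_shapes)
    next
      case (Suc n)
      from certificateD[OF assms Suc.prems] obtain v
        where "triple c (pair u n) v \<in> S" "triple b (triple u n v) w \<in> S"
        unfolding justified_in_def using not_shape shape by auto
      then show ?case
        using Suc.IH[of v] less.IH[of b] PrimRec by (simp add: program_shapes)
    qed
    from this[of "p1 x" "p2 x"] less.prems show ?thesis
      by simp
  next
    case (Mu a)
    have "eval (program a) (pair x y) = Some 0"
      using Mu less.IH by blast
    moreover have "\<exists>v. eval (program a) (pair x m) = Some (Suc v)" if "m < y" for m
      using Mu less.IH that by blast
    ultimately show ?thesis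
      by (auto simp: program_shapes Mu(2) intro!: Least_equality) 
       (metis linorder_le_less_linear nat.distinct(1) option.inject option.distinct(1))+
  qed (simp_all add: program.simps)
qed

section \<open>Completeness of certificates\<close>

lemma code_less: "a < 4 * pair a b + Suc n" "b < 4 * pair a b + Suc n"
  using le_prod_encode_1[of a b] le_prod_encode_2[of b a] by linarith+

lemma justified_in_Pairing:
  "triple a x u \<in> S \<Longrightarrow> triple b x v \<in> S \<Longrightarrow> justified_in S (4 * pair a b + 4) x (pair u v)"
  unfolding justified_in_def
  by (rule disjI2)+ (rule exI[of _ a], rule conjI[rotated], rule exI[of _ b],
    use code_less(1)[of a b 3] code_less(2)[of b a 3] in auto)

lemma justified_in_Comp:
  "triple b x z \<in> S \<Longrightarrow> triple a z y \<in> S \<Longrightarrow> justified_in S (4 * pair a b + 5) x y"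
  unfolding justified_in_def
  by (rule disjI2)+ (rule exI[of _ a], rule conjI[rotated], rule exI[of _ b],
    use code_less(1)[of a b 4] code_less(2)[of b a 4] in auto)

lemma justified_in_PrimRec_0:
  "triple a u y \<in> S \<Longrightarrow> justified_in S (4 * pair a b + 6) (pair u 0) y"
  unfolding justified_in_def
  by (rule disjI2)+ (rule exI[of _ a], rule conjI[rotated], rule exI[of _ b],
    use code_less(1)[of a b 5] code_less(2)[of b a 5] in auto)

lemma justified_in_PrimRec_Suc:
  "triple (4 * pair a b + 6) (pair u n) v \<in> S \<Longrightarrow> triple b (triple u n v) y \<in> S \<Longrightarrow>
    justified_in S (4 * pair a b + 6) (pair u (Suc n)) y"
  unfolding justified_in_def
  by (rule disjI2)+ (rule exI[of _ a], rule conjI[rotated], rule exI[of _ b],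
    use code_less(1)[of a b 5] code_less(2)[of b a 5] in auto)

lemma justified_in_Mu:
  "triple a (pair x y) 0 \<in> S \<Longrightarrow> (\<And>m. m < y \<Longrightarrow> \<exists>v. triple a (pair x m) (Suc v) \<in> S) \<Longrightarrow>
    justified_in S (4 * a + 7) x y"
  unfolding justified_in_def
  by (rule disjI2)+ (rule exI[of _ a], rule conjI[rotated], rule exI[of _ 0], auto)

lemma certified_Pairing:
  assumes "certified a x u" "certified b x v"
  shows "certified (4 * pair a b + 4) x (pair u v)"
  by (rule certified_step[of "{triple a x u, triple b x v}"])
    (use assms in \<open>auto simp: prod_encode_eq intro!: justified_in_Pairing\<close>)

lemma certified_Comp:
  assumes "certified b x z" "certified a z y"
  shows "certified (4 * pair a b + 5) x y"
  by (rule certified_step[of "{triple b x z, triple a z y}"])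
    (use assms in \<open>auto simp: prod_encode_eq intro!: justified_in_Comp[of b x z]\<close>)

lemma certified_PrimRec_0:
  assumes "certified a u y"
  shows "certified (4 * pair a b + 6) (pair u 0) y"
  by (rule certified_step[of "{triple a u y}"])
    (use assms in \<open>auto simp: prod_encode_eq intro!: justified_in_PrimRec_0\<close>)

lemma certified_PrimRec_Suc:
  assumes "certified (4 * pair a b + 6) (pair u n) v" "certified b (triple u n v) y"
  shows "certified (4 * pair a b + 6) (pair u (Suc n)) y"
  by (rule certified_step[of "{triple (4 * pair a b + 6) (pair u n) v, triple b (triple u n v) y}"])
    (use assms in \<open>auto simp: prod_encode_eq intro!: justified_in_PrimRec_Suc[of _ _ _ _ v]\<close>)

lemma certified_Mu:
  assumes "certified a (pair x y) 0" "\<And>m. m < y \<Longrightarrow> certified a (pair x m) (Suc (v m))"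
  shows "certified (4 * a + 7) x y"
  by (rule certified_step[of "insert (triple a (pair x y) 0)
        ((\<lambda>m. triple a (pair x m) (Suc (v m))) ` {..<y})"])
    (use assms in \<open>auto simp: prod_encode_eq intro!: justified_in_Mu\<close>)

text \<open>For \<open>Mu\<close>, minimality makes all earlier values positive, the form
  \<open>Suc (v m)\<close> that the clause asks for. For \<open>PrimRec\<close>, the counter needs
  an induction of its own.\<close>

lemma certified_eval: "eval p x = Some y \<Longrightarrow> certified (program_code p) x y"
proof (induction p arbitrary: x y)
  case (Pairing p q)
  from Pairing.prems obtain u v where uv: "eval p x = Some u" "eval q x = Some v" "y = pair u v"
    by (auto simp: bind_eq_Some_conv)
  from certified_Pairing[OF Pairing.IH(1)[OF uv(1)] Pairing.IH(2)[OF uv(2)]] uv(3)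
  show ?case by simp
next
  case (Comp p q)
  from Comp.prems obtain z where "eval q x = Some z" "eval p z = Some y"
    by (auto simp: bind_eq_Some_conv)
  from certified_Comp[OF Comp.IH(2)[OF this(1)] Comp.IH(1)[OF this(2)]]
  show ?case by simp
next
  case (PrimRec p q)
  have "certified (program_code (PrimRec p q)) (pair u n) w"
    if "eval (PrimRec p q) (pair u n) = Some w" for u n w
    using that
  proof (induction n arbitrary: w)
    case 0
    from "0.prems" have "eval p u = Some w" by simp
    from certified_PrimRec_0[OF PrimRec.IH(1)[OF this]] show ?case by simp
  next
    case (Suc n)
    from Suc.prems obtain v where v: "eval (PrimRec p q) (pair u n) = Some v" "eval q (triple u n v) = Some w"
      by (simp add: bind_eq_Some_conv) blast
    from certified_PrimRec_Suc[OF Suc.IH[OF v(1), unfolded program_code.simps]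
        PrimRec.IH(2)[OF v(2)]]
    show ?case by simp
  qed
  then have "eval (PrimRec p q) x = Some y \<Longrightarrow> certified (program_code (PrimRec p q)) x y"
    by (metis prod.collapse prod_decode_inverse)
  then show ?case
    using PrimRec.prems .
next
  case (Mu p)
  from Mu.prems obtain n where n: "eval p (pair x n) = Some 0" "\<forall>m<n. eval p (pair x m) \<noteq> None"
    and y: "y = (LEAST n. eval p (pair x n) = Some 0)"
    by (auto split: if_splits)
  have 0: "eval p (pair x y) = Some 0"
    unfolding y using n(1) by (rule LeastI)
  have "\<exists>v. eval p (pair x m) = Some (Suc v)" if "m < y" for m
  proof -
    have "y \<le> n"
      unfolding y using n(1) by (rule Least_le)
    then have "eval p (pair x m) \<noteq> None" "eval p (pair x m) \<noteq> Some 0"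
      using n(2) that not_less_Least[of m] unfolding y by auto
    then show ?thesis
      by (cases "eval p (pair x m)") (auto simp: gr0_conv_Suc)
  qed
  then have "\<forall>m. \<exists>v. m < y \<longrightarrow> eval p (pair x m) = Some (Suc v)"
    by blast
  from choice[OF this] obtain v where v: "\<And>m. m < y \<Longrightarrow> eval p (pair x m) = Some (Suc (v m))"
    by blast
  from certified_Mu[OF Mu.IH[OF 0], of v, OF Mu.IH[OF v]] show ?case
    by simp
next
  case Zero
  then show ?case
    by (auto simp: justified_in_def intro!: certified_base)
next
  case Succ
  then show ?case
    by (auto simp: justified_in_def intro!: certified_base)
next
  case Proj1
  then show ?case
    by (auto simp: justified_in_def intro!: certified_base)
next
  case Proj2
  then show ?case
    by (auto simp: justified_in_def intro!: certified_base)
qed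

text \<open>A bound on the code of a certificate stands in for running time: it gives a decidable
  relation that is monotone in \<open>s\<close> and exhausts \<open>eval\<close> as \<open>s\<close>
  grows.\<close>

definition computes_within :: "nat \<Rightarrow> nat \<Rightarrow> nat \<Rightarrow> nat \<Rightarrow> bool" where
  "computes_within s c x y \<longleftrightarrow>
     (\<exists>D<s. certificate (set_decode D) \<and> triple c x y \<in> set_decode D)"

lemma computes_within_mono: "computes_within s c x y \<Longrightarrow> s \<le> t \<Longrightarrow> computes_within t c x y"
  unfolding computes_within_def by (meson order_less_le_trans)

text \<open>Hence searches over inputs and outputs bounded by the same \<open>s\<close> miss no
  computation.\<close>

lemma computes_within_less: "computes_within s c x y \<Longrightarrow> x < s \<and> y < s"
  unfolding computes_within_def by (meson less_trans triple_less(2,3))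

lemma eval_program_code_iff:
  "eval p x = Some y \<longleftrightarrow> (\<exists>s. computes_within s (program_code p) x y)"
proof
  assume "eval p x = Some y"
  from certified_eval[OF this] obtain S
    where "finite S" "certificate S" "triple (program_code p) x y \<in> S"
    unfolding certified_def by blast
  then have "computes_within (Suc (set_encode S)) (program_code p) x y"
    unfolding computes_within_def by (intro exI[of _ "set_encode S"]) simp
  then show "\<exists>s. computes_within s (program_code p) x y" ..
next
  assume "\<exists>s. computes_within s (program_code p) x y"
  then show "eval p x = Some y"
    unfolding computes_within_def using certificate_sound program_program_code by metis
qed

lemma decidable_computes_within [comp_intros]:
  assumes "computable s" "computable c" "computable f" "computable g"
  shows "decidable (\<lambda>x. computes_within (s x) (c x) (f x) (g x))"
  unfolding computes_within_def by (intro comp_intros assms[THEN computable_compose])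

section \<open>Codes of lists\<close>

text \<open>\<open>list_encode\<close> maps the empty list to 0 and a cons cell to the successor of
  a pair.\<close>

definition tl_code :: "nat \<Rightarrow> nat" where
  "tl_code c = p2 (c - Suc 0)"

definition nth_code :: "nat \<Rightarrow> nat \<Rightarrow> nat" where
  "nth_code c k = p1 ((tl_code ^^ k) c - Suc 0)"

lemma list_decode_tl_code: "list_decode (tl_code c) = tl (list_decode c)"
proof (cases c)
  case 0
  \<comment> \<open>Truncated subtraction sends the code 0 to \<open>p2 0\<close>, which must again
    code the empty list.\<close>
  have "p2 0 = 0"
    using le_prod_encode_2[of "p2 0" "p1 0"] by simp
  with 0 show ?thesis
    by (simp add: tl_code_def)
qed (simp add: tl_code_def split: prod.splits)

lemma list_decode_funpow_tl_code: "list_decode ((tl_code ^^ k) c) = drop k (list_decode c)"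
  by (induction k) (simp_all add: list_decode_tl_code tl_drop drop_Suc)

lemma nth_code: "k < length (list_decode c) \<Longrightarrow> nth_code c k = list_decode c ! k"
proof -
  assume k: "k < length (list_decode c)"
  have hd: "p1 (d - Suc 0) = hd (list_decode d)" if "list_decode d \<noteq> []" for d
    using that by (cases d) (auto split: prod.splits)
  show ?thesis
    using k hd[of "(tl_code ^^ k) c"]
    by (simp add: nth_code_def list_decode_funpow_tl_code hd_drop_conv_nth)
qed

lemma computable_tl_code [comp_intros]: "computable f \<Longrightarrow> computable (\<lambda>x. tl_code (f x))"
  unfolding tl_code_def by (intro comp_intros)

lemma computable_nth_code [comp_intros]:
  "computable f \<Longrightarrow> computable g \<Longrightarrow> computable (\<lambda>x. nth_code (f x) (g x))"
  unfolding nth_code_def by (intro comp_intros)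

lemma computable_length_list_decode [comp_intros]:
  assumes "computable f"
  shows "computable (\<lambda>x. length (list_decode (f x)))"
proof -
  have nil: "list_decode d = [] \<longleftrightarrow> d = 0" for d
    by (cases d) (auto split: prod.splits)
  have "length (list_decode c) = (LEAST k. (tl_code ^^ k) c = 0)" for c
    by (rule Least_equality[symmetric])
      (simp_all add: list_decode_funpow_tl_code flip: nil)
  moreover have "computable (\<lambda>x. LEAST k. (tl_code ^^ k) (f x) = 0)"
  proof (intro comp_intros computable_compose[OF assms])
    show "\<exists>k. (tl_code ^^ k) (f x) = 0" for x
      by (rule exI[of _ "length (list_decode (f x))"])
        (simp add: list_decode_funpow_tl_code flip: nil)
  qed
  ultimately show ?thesis by (simp only:)
qed

lemma decidable_all_set_list_decode [comp_intros]:
  assumes "decidable (\<lambda>z. P (p1 z) (p2 z))" "computable f"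
  shows "decidable (\<lambda>x. \<forall>v\<in>set (list_decode (f x)). P x v)"
proof -
  have "(\<forall>v\<in>set (list_decode c). Q v) \<longleftrightarrow> (\<forall>k<length (list_decode c). Q (nth_code c k))" for c Q
    by (simp add: all_set_conv_all_nth nth_code)
  then show ?thesis
    by (simp only:) (intro comp_intros decidable_compose2[OF assms(1)] computable_compose[OF assms(2)])
qed

lemma decidable_prefix_list_decode:
  assumes "computable f" "computable g"
  shows "decidable (\<lambda>x. \<exists>l. list_decode (g x) = list_decode (f x) @ l)"
proof -
  have "(\<exists>l. list_decode d = list_decode c @ l) \<longleftrightarrow>
      length (list_decode c) \<le> length (list_decode d) \<and>
      (\<forall>k<length (list_decode c). nth_code d k = nth_code c k)" (is "?L \<longleftrightarrow> ?R") for c d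
  proof
    assume ?R
    then have "take (length (list_decode c)) (list_decode d) = list_decode c"
      by (intro nth_equalityI) (auto simp: nth_code)
    then show ?L
      by (metis append_take_drop_id)
  qed (auto simp: nth_code nth_append)
  then show ?thesis
    by (simp only:) (intro comp_intros computable_compose[OF assms(1)] computable_compose[OF assms(2)])
qed

section \<open>Locking sequences\<close>

text \<open>The negation says that all defined values of \<open>M\<close> on extensions of
  \<open>\<sigma>\<close> inside \<open>A\<close> agree. Since undefined values are tolerated, two
  halting computations suffice as a witness for being unlocked.\<close>

definition unlocked :: "(nat list \<Rightarrow> nat option) \<Rightarrow> nat set \<Rightarrow> nat list \<Rightarrow> bool" where
  "unlocked M A \<sigma> \<longleftrightarrow> (\<exists>\<tau>1 \<tau>2 u v. set \<tau>1 \<subseteq> A \<and> set \<tau>2 \<subseteq> A \<and>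
     M (\<sigma> @ \<tau>1) = Some u \<and> M (\<sigma> @ \<tau>2) = Some v \<and> u \<noteq> v)"

text \<open>Lets the limit of a learner be tested on enumerations that begin with a prescribed
  string.\<close>

lemma obtain_enumeration:
  assumes "set \<sigma> \<subseteq> A" "A \<noteq> {}"
  obtains f where "enumeration_of f A"
    "\<And>i. length \<sigma> \<le> i \<Longrightarrow> \<exists>\<tau>. set \<tau> \<subseteq> A \<and> initial_segment f i = \<sigma> @ \<tau>"
proof -
  obtain a where "a \<in> A"
    using assms(2) by blast
  define g where "g x = (if x \<in> A then x else a)" for x
  have g: "range g = A"
    using \<open>a \<in> A\<close> by (auto simp: g_def)
  define f where "f j = (if j < length \<sigma> then \<sigma> ! j else g (j - length \<sigma>))" for j
  have "f j \<in> A" for j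
    using assms(1) g by (auto simp: f_def)
  moreover have "x \<in> range f" if "x \<in> A" for x
  proof -
    from that g obtain k where "x = g k"
      by blast
    then have "x = f (length \<sigma> + k)"
      by (simp add: f_def)
    then show ?thesis by blast
  qed
  ultimately have range: "range f = A"
    by blast
  moreover have "initial_segment f i = \<sigma> @ map f [length \<sigma>..<i]" if "length \<sigma> \<le> i" for i
    using that unfolding initial_segment_def
    by (intro nth_equalityI) (auto simp: nth_append f_def)
  moreover have "set (map f xs) \<subseteq> A" for xs
    using range by auto
  ultimately show thesis
    by (intro that[of f]) (auto simp: enumeration_of_def)
qed

text \<open>The locking sequence argument: if all strings over \<open>A\<close> were unlocked, they
  could be extended forever to an enumeration of \<open>A\<close> on which \<open>M\<close> never
  settles.\<close>

lemma learns_imp_locked: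
  assumes "TxtEx_learns M A" "A \<noteq> {}"
  obtains \<sigma> where "set \<sigma> \<subseteq> A" "\<not> unlocked M A \<sigma>"
proof (rule ccontr)
  assume "\<not> thesis"
  with that have unlocked: "unlocked M A \<sigma>" if "set \<sigma> \<subseteq> A" for \<sigma>
    using \<open>set \<sigma> \<subseteq> A\<close> by blast
  obtain g where "enumeration_of g A"
    by (rule obtain_enumeration[of "[]" A]) (use assms(2) in auto)
  then have g: "range g = A"
    by (simp add: enumeration_of_def)
  have "\<exists>\<tau>. set \<tau> \<subseteq> A \<and> M (\<sigma> @ g k # \<tau>) \<noteq> M \<sigma>" if "set \<sigma> \<subseteq> A" for \<sigma> k
  proof -
    have "unlocked M A (\<sigma> @ [g k])"
      using that g by (intro unlocked) auto
    then obtain \<tau>1 \<tau>2 u v where "set \<tau>1 \<subseteq> A" "set \<tau>2 \<subseteq> A" "u \<noteq> v"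
      "M (\<sigma> @ g k # \<tau>1) = Some u" "M (\<sigma> @ g k # \<tau>2) = Some v"
      unfolding unlocked_def by auto
    \<comment> \<open>Two distinct values cannot both equal \<open>M \<sigma>\<close>, even if that
      is undefined.\<close>
    then show ?thesis
      by (cases "M \<sigma> = Some u") auto
  qed
  then have "\<forall>\<sigma> k. \<exists>\<tau>. set \<sigma> \<subseteq> A \<longrightarrow> set \<tau> \<subseteq> A \<and> M (\<sigma> @ g k # \<tau>) \<noteq> M \<sigma>"
    by blast
  then obtain ext where ext: "\<And>\<sigma> k. set \<sigma> \<subseteq> A \<Longrightarrow> set (ext \<sigma> k) \<subseteq> A"
    "\<And>\<sigma> k. set \<sigma> \<subseteq> A \<Longrightarrow> M (\<sigma> @ g k # ext \<sigma> k) \<noteq> M \<sigma>"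
    by metis
  \<comment> \<open>Appending \<open>g k\<close> makes the limit exhaust \<open>A\<close>;
    \<open>ext\<close> forces the change of output.\<close>
  define S where "S = rec_nat [] (\<lambda>k \<sigma>. \<sigma> @ g k # ext \<sigma> k)"
  have S_Suc: "S (Suc k) = S k @ g k # ext (S k) k" for k
    by (simp add: S_def)
  have S_sub: "set (S k) \<subseteq> A" for k
  proof (induction k)
    case (Suc k)
    then show ?case
      using ext(1)[OF Suc] g by (auto simp: S_Suc)
  qed (simp add: S_def)
  have S_len: "k \<le> length (S k)" for k
    by (induction k) (simp_all add: S_Suc)
  have S_nth: "j < length (S k) \<Longrightarrow> S (k + m) ! j = S k ! j \<and> j < length (S (k + m))" for j k m
    by (induction m) (auto simp: S_Suc nth_append)
  \<comment> \<open>\<open>S (Suc j)\<close> has length at least \<open>Suc j\<close>, so entry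
    \<open>j\<close> exists and is already final.\<close>
  define f where "f j = S (Suc j) ! j" for j
  have f: "f j = S k ! j" if "j < length (S k)" for j k
  proof -
    have "j < length (S (Suc j))"
      using S_len[of "Suc j"] by simp
    then show ?thesis
      unfolding f_def using S_nth[of j "Suc j" k] S_nth[OF that, of "Suc j"]
      by (simp add: add.commute)
  qed
  have seg: "initial_segment f (length (S k)) = S k" for k
    unfolding initial_segment_def by (intro nth_equalityI) (auto simp: f)
  have "range f = A"
  proof
    have "S (Suc j) ! j \<in> set (S (Suc j))" for j
      using S_len[of "Suc j"] by simp
    then show "range f \<subseteq> A"
      using S_sub unfolding f_def by blast
    show "A \<subseteq> range f"
    proof
      fix x
      assume "x \<in> A"
      then obtain k where "x = g k"
        using g by blast
      then have "x \<in> set (S (Suc k))"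
        by (simp add: S_Suc)
      then obtain j where "j < length (S (Suc k))" "S (Suc k) ! j = x"
        by (auto simp: in_set_conv_nth)
      then show "x \<in> range f"
        using f by (metis rangeI)
    qed
  qed
  then have "TxtEx_identifies M f"
    using assms(1) unfolding TxtEx_learns_def enumeration_of_def by blast
  then obtain n k where n: "\<And>i. i \<ge> k \<Longrightarrow> M (initial_segment f i) = Some n"
    unfolding TxtEx_identifies_def by blast
  \<comment> \<open>Both strings are initial segments of \<open>f\<close> of length at least
    \<open>k\<close>, hence past the point of convergence.\<close>
  have "M (S k) = Some n" "M (S (Suc k)) = Some n"
    using n[OF S_len] n[of "length (S (Suc k))"] S_len[of "Suc k"] by (simp_all only: seg)
  moreover have "M (S (Suc k)) \<noteq> M (S k)"
    unfolding S_Suc by (rule ext(2)[OF S_sub])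
  ultimately show False
    by simp
qed

text \<open>Enumerations of \<open>A\<close> and of \<open>B\<close> may both start with
  \<open>\<sigma>\<close>, and both limits are values of \<open>M\<close> on extensions of
  \<open>\<sigma>\<close> inside \<open>A\<close>. Locking makes them equal, although they index
  different sets.\<close>

lemma locked_not_learns_both:
  assumes "\<not> unlocked M A \<sigma>" "set \<sigma> \<subseteq> B" "B \<subset> A" "B \<noteq> {}"
    "TxtEx_learns M A" "TxtEx_learns M B"
  shows False
proof -
  have *: "\<exists>n \<tau>. set \<tau> \<subseteq> X \<and> M (\<sigma> @ \<tau>) = Some n \<and> W n = X"
    if X: "set \<sigma> \<subseteq> X" "X \<noteq> {}" "TxtEx_learns M X" for X
  proof -
    obtain f where f: "enumeration_of f X"
      "\<And>i. length \<sigma> \<le> i \<Longrightarrow> \<exists>\<tau>. set \<tau> \<subseteq> X \<and> initial_segment f i = \<sigma> @ \<tau>"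
      using obtain_enumeration[OF X(1,2)] by blast
    then obtain n k where n: "\<And>i. i \<ge> k \<Longrightarrow> M (initial_segment f i) = Some n" "W n = X"
      using X(3) unfolding TxtEx_learns_def TxtEx_identifies_def enumeration_of_def by metis
    obtain \<tau> where "set \<tau> \<subseteq> X" "initial_segment f (max k (length \<sigma>)) = \<sigma> @ \<tau>"
      using f(2)[of "max k (length \<sigma>)"] by auto
    then show ?thesis
      using n(1)[of "max k (length \<sigma>)"] n(2) by auto
  qed
  obtain m \<tau>1 where 1: "set \<tau>1 \<subseteq> A" "M (\<sigma> @ \<tau>1) = Some m" "W m = A"
    using *[of A] assms by blast
  obtain n \<tau>2 where 2: "set \<tau>2 \<subseteq> B" "M (\<sigma> @ \<tau>2) = Some n" "W n = B"
    using *[of B] assms by blast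
  have "m = n"
    using assms(1,3) 1 2 unfolding unlocked_def by blast
  with 1 2 assms(3) show False
    by blast
qed

text \<open>Used to see that a slice growing up to the code of a string over the tagged set contains
  the entries of that string.\<close>

lemma less_list_encode: "x \<in> set l \<Longrightarrow> x < list_encode l"
proof (induction l)
  case (Cons a l)
  then show ?case
    using le_prod_encode_1[of a "list_encode l"] le_prod_encode_2[of "list_encode l" a] by auto
qed simp

section \<open>The diagonal sets\<close>

text \<open>Stage \<open>s\<close> of \<open>unlocked\<close> for program \<open>p1 i\<close> on the
  numbers with tag \<open>i\<close>. A string with a foreign tag is no candidate for a locking
  sequence there and counts as refuted from the start.\<close>

definition refuted_within :: "nat \<Rightarrow> nat \<Rightarrow> nat \<Rightarrow> bool" where
  "refuted_within s i \<sigma> \<longleftrightarrow> \<not> (\<forall>x\<in>set (list_decode \<sigma>). p1 x = i) \<or>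
     (\<exists>\<rho>1<s. \<exists>\<rho>2<s. \<exists>u<s. \<exists>v<s.
       (\<exists>l. list_decode \<rho>1 = list_decode \<sigma> @ l) \<and> (\<exists>l. list_decode \<rho>2 = list_decode \<sigma> @ l) \<and>
       (\<forall>x\<in>set (list_decode \<rho>1). p1 x = i) \<and> (\<forall>x\<in>set (list_decode \<rho>2). p1 x = i) \<and>
       computes_within s (p1 i) \<rho>1 u \<and> computes_within s (p1 i) \<rho>2 v \<and> u \<noteq> v)"

lemma refuted_within_mono: "refuted_within s i \<sigma> \<Longrightarrow> s \<le> t \<Longrightarrow> refuted_within t i \<sigma>"
  unfolding refuted_within_def
  by (elim disj_forward ex_forward conj_forward;
      (assumption | erule (1) order_less_le_trans | erule (1) computes_within_mono))

lemma decidable_refuted_within [comp_intros]: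
  assumes "computable f" "computable g" "computable h"
  shows "decidable (\<lambda>x. refuted_within (f x) (g x) (h x))"
  unfolding refuted_within_def
  by (intro comp_intros decidable_prefix_list_decode assms[THEN computable_compose])

abbreviation tagged :: "nat \<Rightarrow> nat set" where
  "tagged i \<equiv> {x. p1 x = i}"

lemma refuted_within_iff_unlocked:
  assumes M: "\<And>l. M l = eval p (list_encode l)" and i: "p1 i = program_code p"
    and \<sigma>: "set (list_decode \<sigma>) \<subseteq> tagged i"
  shows "(\<exists>s. refuted_within s i \<sigma>) \<longleftrightarrow> unlocked M (tagged i) (list_decode \<sigma>)"
proof
  assume "\<exists>s. refuted_within s i \<sigma>"
  then obtain s \<rho>1 \<rho>2 u v l1 l2 where *:
    "list_decode \<rho>1 = list_decode \<sigma> @ l1" "list_decode \<rho>2 = list_decode \<sigma> @ l2"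
    "\<forall>x\<in>set (list_decode \<rho>1). p1 x = i" "\<forall>x\<in>set (list_decode \<rho>2). p1 x = i"
    "computes_within s (p1 i) \<rho>1 u" "computes_within s (p1 i) \<rho>2 v" "u \<noteq> v"
    using \<sigma> unfolding refuted_within_def by blast
  have "M (list_decode \<rho>1) = Some u" "M (list_decode \<rho>2) = Some v"
    using *(5,6) by (auto simp: M i eval_program_code_iff)
  with * show "unlocked M (tagged i) (list_decode \<sigma>)"
    unfolding unlocked_def by (intro exI[of _ l1] exI[of _ l2] exI[of _ u] exI[of _ v]) auto
next
  assume "unlocked M (tagged i) (list_decode \<sigma>)"
  then obtain l1 l2 u v where *: "set l1 \<subseteq> tagged i" "set l2 \<subseteq> tagged i" "u \<noteq> v"
    "eval p (list_encode (list_decode \<sigma> @ l1)) = Some u"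
    "eval p (list_encode (list_decode \<sigma> @ l2)) = Some v"
    unfolding unlocked_def M by blast
  let ?\<rho>1 = "list_encode (list_decode \<sigma> @ l1)" and ?\<rho>2 = "list_encode (list_decode \<sigma> @ l2)"
  obtain s1 s2 where "computes_within s1 (p1 i) ?\<rho>1 u" "computes_within s2 (p1 i) ?\<rho>2 v"
    using *(4,5) unfolding i eval_program_code_iff by blast
  then have c: "computes_within (max s1 s2) (p1 i) ?\<rho>1 u" "computes_within (max s1 s2) (p1 i) ?\<rho>2 v"
    by (auto elim: computes_within_mono)
  have "refuted_within (max s1 s2) i \<sigma>"
    unfolding refuted_within_def
    by (rule disjI2, rule exI[of _ ?\<rho>1], rule conjI[rotated], rule exI[of _ ?\<rho>2],
        rule conjI[rotated], rule exI[of _ u], rule conjI[rotated], rule exI[of _ v])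
      (use * c \<sigma> computes_within_less[OF c(1)] computes_within_less[OF c(2)] in auto)
  then show "\<exists>s. refuted_within s i \<sigma>" ..
qed

text \<open>
  If \<open>\<forall>c. \<exists>d. A c d\<close>, the slice stops growing exactly at the least (code of a) locking sequence
  of machine \<open>p1 i\<close> on \<open>tagged i\<close>, and contains the elements of that sequence.
\<close>

definition in_slice_within :: "nat \<Rightarrow> (nat \<Rightarrow> nat \<Rightarrow> bool) \<Rightarrow> nat \<Rightarrow> nat \<Rightarrow> bool" where
  "in_slice_within s A i v \<longleftrightarrow>
     (\<forall>c<Suc v. \<exists>d<s. A c d) \<and> (\<forall>\<sigma><v. refuted_within s i \<sigma>)"

definition slice :: "(nat \<Rightarrow> nat \<Rightarrow> bool) \<Rightarrow> nat \<Rightarrow> nat set" where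
  "slice A i = {x. p1 x = i \<and> (\<exists>s. in_slice_within s A i (p2 x))}"

lemma in_slice_within_mono:
  "in_slice_within s A i v \<Longrightarrow> s \<le> t \<Longrightarrow> w \<le> v \<Longrightarrow> in_slice_within t A i w"
  unfolding in_slice_within_def
  by (meson refuted_within_mono order_less_le_trans Suc_le_mono)

text \<open>The maximum of finitely many stages works, by monotonicity.\<close>

lemma uniform_bound:
  assumes "\<And>k. k < n \<Longrightarrow> \<exists>s. P k s" "\<And>k s t. P k s \<Longrightarrow> s \<le> t \<Longrightarrow> P k t"
  shows "\<exists>s::nat. \<forall>k<n::nat. P k s"
  using assms(1)
proof (induction n)
  case (Suc n)
  then obtain s where s: "\<forall>k<n. P k s"
    by auto
  obtain t where t: "P n t"
    using Suc.prems by blast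
  have "P k (max s t)" if "k < Suc n" for k
    using s t that by (auto simp: less_Suc_eq intro: assms(2))
  then show ?case
    by blast
qed simp

lemma ex_in_slice_within_iff:
  "(\<exists>s. in_slice_within s A i v) \<longleftrightarrow>
     (\<forall>c\<le>v. \<exists>d. A c d) \<and> (\<forall>\<sigma><v. \<exists>s. refuted_within s i \<sigma>)"
proof
  assume "(\<forall>c\<le>v. \<exists>d. A c d) \<and> (\<forall>\<sigma><v. \<exists>s. refuted_within s i \<sigma>)"
  then have A: "\<And>c. c < Suc v \<Longrightarrow> \<exists>s. \<exists>d<s. A c d"
    and B: "\<And>\<sigma>. \<sigma> < v \<Longrightarrow> \<exists>s. refuted_within s i \<sigma>"
    by (meson less_Suc_eq_le lessI)+
  obtain s where s: "\<forall>c<Suc v. \<exists>d<s. A c d"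
    using uniform_bound[of "Suc v" "\<lambda>c s. \<exists>d<s. A c d", OF A] by (meson order_less_le_trans)
  obtain t where t: "\<forall>\<sigma><v. refuted_within t i \<sigma>"
    using uniform_bound[of v "\<lambda>\<sigma> s. refuted_within s i \<sigma>", OF B] refuted_within_mono by blast
  have "in_slice_within (max s t) A i v"
    unfolding in_slice_within_def
    using s t by (meson less_max_iff_disj max.cobounded2 refuted_within_mono)
  then show "\<exists>s. in_slice_within s A i v" ..
qed (auto simp: in_slice_within_def less_Suc_eq_le)

lemma slice_downward:
  "pair i v \<in> slice A i \<Longrightarrow> w \<le> v \<Longrightarrow> pair i w \<in> slice A i"
  unfolding slice_def using in_slice_within_mono by fastforce

text \<open>Slices are closed downward in the second component, so an infinite one contains every
  level, and level \<open>v\<close> certifies \<open>\<exists>d. A c d\<close> for all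
  \<open>c \<le> v\<close>.\<close>

lemma infinite_slice:
  assumes "infinite (slice A i)"
  shows "slice A i = tagged i" "\<forall>c. \<exists>d. A c d"
proof -
  have large: "\<exists>w\<ge>v. pair i w \<in> slice A i" for v
  proof (rule ccontr)
    assume no: "\<not> (\<exists>w\<ge>v. pair i w \<in> slice A i)"
    have "slice A i \<subseteq> pair i ` {..<v}"
    proof
      fix x
      assume x: "x \<in> slice A i"
      then have "x = pair i (p2 x)"
        by (auto simp: slice_def)
      with x no show "x \<in> pair i ` {..<v}"
        by (metis imageI lessThan_iff not_le)
    qed
    with assms show False
      using finite_surj finite_lessThan by blast
  qed
  have all: "pair i v \<in> slice A i" for v
    using large[of v] slice_downward by blast
  show "slice A i = tagged i"
  proof
    show "tagged i \<subseteq> slice A i"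
    proof
      fix x
      assume "x \<in> tagged i"
      then have "x = pair i (p2 x)"
        by auto
      then show "x \<in> slice A i"
        using all by metis
    qed
  qed (auto simp: slice_def)
  show "\<forall>c. \<exists>d. A c d"
    using all by (auto simp: slice_def ex_in_slice_within_iff)
qed

text \<open>A learner of \<open>tagged i\<close> has a locking sequence. The least code
  \<open>\<sigma>\<close> of one stops the slice, which becomes a proper subset containing that
  sequence, against \<open>locked_not_learns_both\<close>.\<close>

lemma not_learns_tagged_and_slice:
  assumes M: "\<And>l. M l = eval p (list_encode l)" and i: "p1 i = program_code p"
    and A: "\<forall>c. \<exists>d. A c d"
    and learns: "TxtEx_learns M (tagged i)" "TxtEx_learns M (slice A i)"
  shows False
proof -
  define locked where "locked \<sigma> \<longleftrightarrow>
    set (list_decode \<sigma>) \<subseteq> tagged i \<and> \<not> unlocked M (tagged i) (list_decode \<sigma>)" for \<sigma>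
  have refuted: "(\<exists>s. refuted_within s i \<sigma>) \<longleftrightarrow> \<not> locked \<sigma>" for \<sigma>
  proof (cases "set (list_decode \<sigma>) \<subseteq> tagged i")
    case True
    then show ?thesis
      using refuted_within_iff_unlocked[OF M i True] by (simp add: locked_def)
  next
    case False
    then show ?thesis
      by (auto simp: locked_def refuted_within_def)
  qed
  have "tagged i \<noteq> {}"
    by (auto intro: exI[of _ "pair i 0"])
  with learns(1) obtain l where "set l \<subseteq> tagged i" "\<not> unlocked M (tagged i) l"
    by (rule learns_imp_locked)
  then have "locked (list_encode l)"
    by (simp add: locked_def)
  then obtain \<sigma> where \<sigma>: "locked \<sigma>" "\<And>\<tau>. \<tau> < \<sigma> \<Longrightarrow> \<not> locked \<tau>"
    using exists_least_iff[of locked] by blast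
  \<comment> \<open>Level \<open>v\<close> asks for refutation of codes strictly below
    \<open>v\<close>, so level \<open>\<sigma>\<close> still enters and level
    \<open>Suc \<sigma>\<close> is the first that does not.\<close>
  have slice: "x \<in> slice A i \<longleftrightarrow> x \<in> tagged i \<and> p2 x \<le> \<sigma>" for x
    unfolding slice_def using \<sigma> A
    by (auto simp: ex_in_slice_within_iff refuted not_le[symmetric])
  have "set (list_decode \<sigma>) \<subseteq> slice A i"
  proof
    fix x
    assume x: "x \<in> set (list_decode \<sigma>)"
    have "p2 x \<le> x"
      using le_prod_encode_2[of "p2 x" "p1 x"] by simp
    with less_list_encode[OF x] have "p2 x \<le> \<sigma>"
      by simp
    with x \<sigma>(1) show "x \<in> slice A i"
      by (auto simp: slice locked_def)
  qed
  moreover have "pair i (Suc \<sigma>) \<in> tagged i - slice A i" "pair i 0 \<in> slice A i"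
    by (simp_all add: slice)
  then have "slice A i \<subset> tagged i" "slice A i \<noteq> {}"
    using slice by blast+
  ultimately show False
    using locked_not_learns_both learns \<sigma>(1) unfolding locked_def by blast
qed

section \<open>A normal form for fourth-level predicates\<close>

lemma Sigma0_4_form:
  assumes "Sigma0 4 P"
  obtains R where "decidable R"
    "\<And>e. P e \<longleftrightarrow> (\<exists>n. \<forall>y. \<exists>c. \<forall>d. R (pair (pair (pair (pair e n) y) c) d))"
proof -
  have "4 = Suc (Suc (Suc (Suc 0)))"
    by simp
  with assms obtain Q1 Q2 Q3 Q4 where
    "\<And>x. P x \<longleftrightarrow> (\<exists>y. Q1 (pair x y))" "\<And>x. Q1 x \<longleftrightarrow> (\<forall>y. Q2 (pair x y))"
    "\<And>x. Q2 x \<longleftrightarrow> (\<exists>y. Q3 (pair x y))" "\<And>x. Q3 x \<longleftrightarrow> (\<forall>y. Q4 (pair x y))" "decidable Q4"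
    unfolding Sigma0.simps Pi0.simps by (simp only: Sigma0.simps Pi0.simps) metis
  then show thesis
    by (intro that[of Q4]) auto
qed

text \<open>
  If the sets \<open>{d. A y c d}\<close> are nonempty for all \<open>c\<close>, call \<open>y\<close> good. A code \<open>w\<close> of a list of
  length \<open>y\<close> satisfies the condition for all \<open>c\<close> and some \<open>d\<close> iff \<open>y\<close> is the least good number
  and the list gives, for each smaller number, the least \<open>c\<close> that shows that it is not good.
\<close>

definition least_good :: "(nat \<Rightarrow> nat \<Rightarrow> nat \<Rightarrow> bool) \<Rightarrow> nat \<Rightarrow> nat \<Rightarrow> nat \<Rightarrow> bool" where
  "least_good A w c d \<longleftrightarrow>
     (\<forall>b<Suc c. \<exists>a<d. A (length (list_decode w)) b a) \<and>
     (\<forall>y<length (list_decode w).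
        (\<forall>b<nth_code w y. \<exists>a<d. A y b a) \<and> \<not> A y (nth_code w y) c)"

text \<open>The argument \<open>c\<close> serves twice, as the bound for \<open>b\<close> and as the
  value at which \<open>\<not> A\<close> is tested, so that all requirements fit under one prefix
  \<open>\<forall>c. \<exists>d\<close>. The bound \<open>d\<close> collects finitely many
  witnesses.\<close>

lemma all_ex_least_good_iff:
  "(\<forall>c. \<exists>d. least_good A w c d) \<longleftrightarrow>
     (\<forall>c. \<exists>d. A (length (list_decode w)) c d) \<and>
     (\<forall>y<length (list_decode w).
        (\<forall>b<nth_code w y. \<exists>d. A y b d) \<and> (\<forall>d. \<not> A y (nth_code w y) d))"
  (is "?L \<longleftrightarrow> ?R")
proof
  assume ?L
  then show ?R
    unfolding least_good_def by (meson lessI)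
next
  assume ?R
  show ?L
  proof
    fix c
    let ?n = "length (list_decode w)"
    have bounded: "\<exists>d. \<forall>b<k. \<exists>a<d. A y b a" if "\<And>b. b < k \<Longrightarrow> \<exists>a. A y b a" for k y
      by (rule uniform_bound[of k "\<lambda>b d. \<exists>a<d. A y b a"])
        (use that in \<open>meson lessI\<close>, meson order_less_le_trans)
    have "\<exists>d. \<forall>b<Suc c. \<exists>a<d. A ?n b a"
      using \<open>?R\<close> by (intro bounded) blast
    then obtain d1 where d1: "\<forall>b<Suc c. \<exists>a<d1. A ?n b a" ..
    have "\<exists>d. \<forall>y<?n. \<forall>b<nth_code w y. \<exists>a<d. A y b a"
    proof (rule uniform_bound)
      show "\<exists>d. \<forall>b<nth_code w y. \<exists>a<d. A y b a" if "y < ?n" for y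
        using \<open>?R\<close> that by (intro bounded) blast
      show "\<forall>b<nth_code w y. \<exists>a<t. A y b a"
        if "\<forall>b<nth_code w y. \<exists>a<s. A y b a" "s \<le> t" for y s t
        using that by (meson order_less_le_trans)
    qed
    then obtain d2 where d2: "\<forall>y<?n. \<forall>b<nth_code w y. \<exists>a<d2. A y b a" ..
    have "least_good A w c (max d1 d2)"
      unfolding least_good_def using d1 d2 \<open>?R\<close> by (meson less_max_iff_disj)
    then show "\<exists>d. least_good A w c d" ..
  qed
qed

text \<open>Of two different lengths, the smaller would be good by one list and refuted by the
  other. Entries agree because each is the least \<open>c\<close> without a witness.\<close>

lemma all_ex_least_good_unique:
  assumes "\<forall>c. \<exists>d. least_good A v c d" "\<forall>c. \<exists>d. least_good A w c d"
  shows "v = w"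
proof -
  note v = assms(1)[unfolded all_ex_least_good_iff] and w = assms(2)[unfolded all_ex_least_good_iff]
  have len: "length (list_decode v) = length (list_decode w)"
    using v w by (meson linorder_neqE_nat)
  moreover have "list_decode v ! y = list_decode w ! y" if "y < length (list_decode v)" for y
  proof -
    have "nth_code v y = nth_code w y"
      using v w that len by (metis linorder_neqE_nat)
    then show ?thesis
      using that len by (simp add: nth_code)
  qed
  ultimately have "list_decode v = list_decode w"
    by (rule nth_equalityI)
  then show ?thesis
    by (simp add: list_decode_eq)
qed

lemma ex_least_good:
  assumes "\<exists>y. \<forall>c. \<exists>d. A y c d"
  shows "\<exists>w. \<forall>c. \<exists>d. least_good A w c d"
proof -
  define good where "good y \<longleftrightarrow> (\<forall>c. \<exists>d. A y c d)" for y
  obtain y where y: "good y" "\<And>x. x < y \<Longrightarrow> \<not> good x"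
    using assms exists_least_iff[of good] unfolding good_def by blast
  define b where "b x = (LEAST c. \<forall>d. \<not> A x c d)" for x
  have b: "\<forall>d. \<not> A x (b x) d" if "x < y" for x
    unfolding b_def by (rule LeastI_ex) (use y(2)[OF that] in \<open>auto simp: good_def\<close>)
  have "\<exists>d. A x c d" if "c < b x" for x c
    using not_less_Least[of c "\<lambda>c. \<forall>d. \<not> A x c d"] that unfolding b_def by blast
  with b y(1) show ?thesis
    by (intro exI[of _ "list_encode (map b [0..<y])"])
      (simp add: all_ex_least_good_iff good_def nth_code)
qed

text \<open>
  Codes \<open>y\<close> of tuples of witnesses for all \<open>m \<le> n\<close> make the condition \<open>\<exists>y\<close> antitone in \<open>n\<close>,
  and \<^const>\<open>least_good\<close> makes the witness unique.
\<close>

lemma Sigma0_4_finite_form: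
  assumes "Sigma0 4 P"
  obtains Q where "decidable Q"
    "\<And>e. P e \<Longrightarrow> finite {i. \<forall>c. \<exists>d. Q (pair e (triple i c d))}"
    "\<And>e n. \<not> P e \<Longrightarrow> \<exists>w. \<forall>c. \<exists>d. Q (pair e (triple (pair n w) c d))"
proof -
  obtain R where R: "decidable R"
    and P: "\<And>e. P e \<longleftrightarrow> (\<exists>n. \<forall>y. \<exists>c. \<forall>d. R (pair (pair (pair (pair e n) y) c) d))"
    using Sigma0_4_form[OF assms] by blast
  \<comment> \<open>Entry \<open>m\<close> of the list coded by \<open>y\<close> is the witness for
    \<open>m\<close>, and \<open>d\<close> bounds a common search for counterexamples to
    \<open>R\<close>.\<close>
  define A where "A e n y c d \<longleftrightarrow>
    (\<forall>m<Suc n. \<exists>a<Suc d. \<not> R (pair (pair (pair (pair e m) (nth_code y m)) c) a))" for e n y c d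
  define Q where "Q z \<longleftrightarrow> least_good (A (p1 z) (p1 (p1 (p2 z)))) (p2 (p1 (p2 z)))
    (p1 (p2 (p2 z))) (p2 (p2 (p2 z)))" for z
  have "decidable Q"
    unfolding Q_def[abs_def] least_good_def A_def
    by (intro comp_intros decidable_compose[OF R])
  have Q: "Q (pair e (triple (pair n w) c d)) = least_good (A e n) w c d" for e n w c d
    by (simp add: Q_def)
  have "finite {i. \<forall>c. \<exists>d. Q (pair e (triple i c d))}" if "P e" for e
  proof -
    obtain n where n: "\<And>y. \<exists>c. \<forall>d. R (pair (pair (pair (pair e n) y) c) d)"
      using \<open>P e\<close> P by blast
    \<comment> \<open>A witness \<open>n\<close> for \<open>P e\<close> defeats every
      \<open>m \<ge> n\<close>, because the condition at \<open>m\<close> includes the one at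
      \<open>n\<close>.\<close>
    have bound: "m < n" if "\<forall>c. \<exists>d. least_good (A e m) w c d" for m w
    proof (rule ccontr)
      assume "\<not> m < n"
      moreover have "\<forall>c. \<exists>d. A e m (length (list_decode w)) c d"
        using that unfolding all_ex_least_good_iff by blast
      ultimately have "\<forall>c. \<exists>a. \<not> R (pair (pair (pair (pair e n)
          (nth_code (length (list_decode w)) n)) c) a)"
        unfolding A_def by (meson less_Suc_eq_le not_less)
      with n show False
        by blast
    qed
    let ?I = "{i. \<forall>c. \<exists>d. Q (pair e (triple i c d))}"
    have Q': "(\<forall>c. \<exists>d. Q (pair e (triple i c d))) \<longleftrightarrow>
        (\<forall>c. \<exists>d. least_good (A e (p1 i)) (p2 i) c d)" for i
      using Q[of e "p1 i" "p2 i"] by simp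
    \<comment> \<open>The second component is determined by the first, and the first is below
      \<open>n\<close>; hence the set is finite.\<close>
    have "inj_on p1 ?I"
    proof (rule inj_onI)
      fix i j
      assume ij: "i \<in> ?I" "j \<in> ?I" "p1 i = p1 j"
      then have "p2 i = p2 j"
        using all_ex_least_good_unique[of "A e (p1 i)" "p2 i" "p2 j"] by (simp add: Q')
      with ij(3) show "i = j"
        by (metis prod_decode_eq prod_eqI)
    qed
    moreover have "p1 ` ?I \<subseteq> {..<n}"
      using bound by (auto simp: Q')
    ultimately show ?thesis
      using finite_imageD[OF finite_subset[OF _ finite_lessThan]] by blast
  qed
  moreover have "\<exists>w. \<forall>c. \<exists>d. Q (pair e (triple (pair n w) c d))" if "\<not> P e" for e n
  proof -
    have "\<forall>m. \<exists>y. \<forall>c. \<exists>d. \<not> R (pair (pair (pair (pair e m) y) c) d)"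
      using \<open>\<not> P e\<close> P by blast
    from choice[OF this] obtain f
      where f: "\<And>m c. \<exists>d. \<not> R (pair (pair (pair (pair e m) (f m)) c) d)"
      by blast
    define y where "y = list_encode (map f [0..<Suc n])"
    have y: "nth_code y m = f m" if "m < Suc n" for m
      using that nth_code[of m y] by (simp add: y_def del: upt_Suc)
    have "\<exists>d. A e n y c d" for c
    proof -
      have "\<exists>d. \<forall>m<Suc n. \<exists>a<Suc d. \<not> R (pair (pair (pair (pair e m) (f m)) c) a)"
      proof (rule uniform_bound)
        show "\<exists>d. \<exists>a<Suc d. \<not> R (pair (pair (pair (pair e m) (f m)) c) a)" for m
          using f[of m c] by (meson lessI)
        show "\<exists>a<Suc t. \<not> R (pair (pair (pair (pair e m) (f m)) c) a)"
          if "\<exists>a<Suc s. \<not> R (pair (pair (pair (pair e m) (f m)) c) a)" "s \<le> t" for m s t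
          using that by (meson Suc_le_mono order_less_le_trans)
      qed
      then show ?thesis
        unfolding A_def using y by auto
    qed
    then show ?thesis
      unfolding Q by (intro ex_least_good) blast
  qed
  ultimately show thesis
    using \<open>decidable Q\<close> that by blast
qed

section \<open>The reduction\<close>

text \<open>The members of \<open>B\<close> are written into the program. The learner is thus
  obtained nonuniformly: \<open>B\<close> need not be computable from \<open>e\<close>.\<close>

lemma decidable_finite:
  assumes "finite B" "computable f"
  shows "decidable (\<lambda>x. f x \<in> B)"
  using assms(1)
proof induction
  case (insert b B)
  then show ?case
    unfolding insert_iff by (intro comp_intros assms(2))
qed (simp add: decidable_const)

text \<open>
  Strings with a tag in \<open>B\<close> are hard-coded. For the other tags the slice is finite, so the
  stage-wise membership test of the data is eventually correct.
\<close>

definition guess :: "(nat \<Rightarrow> nat) \<Rightarrow> (nat \<Rightarrow> nat \<Rightarrow> nat \<Rightarrow> bool) \<Rightarrow> nat set \<Rightarrow> nat \<Rightarrow> nat" where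
  "guess G A B x =
     (if p1 (nth_code x 0) \<notin> B \<and>
         (\<forall>z\<in>set (list_decode x).
            in_slice_within (length (list_decode x)) (A (p1 (nth_code x 0))) (p1 (nth_code x 0)) (p2 z))
      then G (pair (p1 (nth_code x 0)) 1) else G (pair (p1 (nth_code x 0)) 0))"

text \<open>All data carry the same tag, so the first entry, present since \<open>0 < k\<close>,
  reveals \<open>i\<close>.\<close>

lemma guess_initial_segment:
  assumes "range f \<subseteq> tagged i" "0 < k"
  shows "guess G A B (list_encode (initial_segment f k)) =
    (if i \<notin> B \<and> (\<forall>j<k. in_slice_within k (A i) i (p2 (f j))) then G (pair i 1) else G (pair i 0))"
proof -
  have "p1 (nth_code (list_encode (initial_segment f k)) 0) = i"
    using assms by (simp add: nth_code initial_segment_def image_subset_iff)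
  moreover have "length (initial_segment f k) = k" "set (initial_segment f k) = f ` {..<k}"
    by (auto simp: initial_segment_def)
  ultimately show ?thesis
    by (auto simp: guess_def)
qed

text \<open>For \<open>i \<notin> B\<close> the finite slice misses an element of
  \<open>tagged i\<close>, which passes no stage and forces the guess \<open>G (pair i 0)\<close>
  once it appears; the elements of the slice itself all enter by a common stage. For
  \<open>i \<in> B\<close> the two sets coincide.\<close>

lemma guess_learns:
  assumes W0: "\<And>i. W (G (pair i 0)) = tagged i" and W1: "\<And>i. W (G (pair i 1)) = slice (A i) i"
    and B: "B = {i. infinite (slice (A i) i)}"
  defines "M \<equiv> \<lambda>l. Some (guess G A B (list_encode l))"
  shows "TxtEx_learns M (tagged i)" "TxtEx_learns M (slice (A i) i)"
proof -
  show "TxtEx_learns M (tagged i)"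
    unfolding TxtEx_learns_def enumeration_of_def
  proof (intro allI impI)
    fix f :: "nat \<Rightarrow> nat"
    assume f: "range f = tagged i"
    have "\<exists>k. \<forall>j\<ge>k. M (initial_segment f j) = Some (G (pair i 0))"
    proof (cases "i \<in> B")
      case True
      then show ?thesis
        using f by (intro exI[of _ 1]) (auto simp: M_def guess_initial_segment[of f i])
    next
      case False
      have "infinite (tagged i)"
      proof
        assume "finite (tagged i)"
        moreover have "range (pair i) \<subseteq> tagged i" "inj (pair i)"
          by (auto simp: inj_on_def prod_encode_eq)
        ultimately show False
          using finite_subset finite_imageD infinite_UNIV_nat by blast
      qed
      moreover have "finite (slice (A i) i)"
        using False B by simp
      ultimately have "\<not> tagged i \<subseteq> slice (A i) i"
        using finite_subset by blast
      then obtain x where x: "x \<in> tagged i" "x \<notin> slice (A i) i"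
        by blast
      then obtain n where "x = f n"
        using f by blast
      with x have n: "p1 (f n) = i" "f n \<notin> slice (A i) i"
        by simp_all
      then have "\<not> in_slice_within s (A i) i (p2 (f n))" for s
        by (auto simp: slice_def)
      then have "M (initial_segment f j) = Some (G (pair i 0))" if "Suc n \<le> j" for j
        using that f by (auto simp: M_def guess_initial_segment[of f i] Suc_le_eq)
      then show ?thesis by blast
    qed
    then show "TxtEx_identifies M f"
      unfolding TxtEx_identifies_def using f W0 by blast
  qed
  show "TxtEx_learns M (slice (A i) i)"
  proof (cases "i \<in> B")
    case True
    then show ?thesis
      using \<open>TxtEx_learns M (tagged i)\<close> infinite_slice(1) B by simp
  next
    case False
    show ?thesis
      unfolding TxtEx_learns_def enumeration_of_def
    proof (intro allI impI)
      fix f :: "nat \<Rightarrow> nat"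
      assume f: "range f = slice (A i) i"
      then have sub: "range f \<subseteq> tagged i"
        by (auto simp: slice_def)
      have "finite (p2 ` range f)"
        using False B f by simp
      then obtain n where n: "\<And>j. p2 (f j) < n"
        unfolding finite_nat_set_iff_bounded by blast
      have "\<exists>s. \<forall>v<n. pair i v \<in> range f \<longrightarrow> in_slice_within s (A i) i v"
        unfolding f
      proof (rule uniform_bound)
        show "\<exists>s. pair i v \<in> slice (A i) i \<longrightarrow> in_slice_within s (A i) i v" for v
          by (auto simp: slice_def)
      qed (blast intro: in_slice_within_mono)
      then obtain s where s: "\<And>v. v < n \<Longrightarrow> pair i v \<in> range f \<Longrightarrow> in_slice_within s (A i) i v"
        by blast
      have "in_slice_within k (A i) i (p2 (f j))" if "s \<le> k" for j k
      proof -
        have "p1 (f j) = i"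
          using sub by auto
        then have "pair i (p2 (f j)) = f j"
          by auto
        then have "in_slice_within s (A i) i (p2 (f j))"
          using s n by (metis rangeI)
        then show ?thesis
          using that by (rule in_slice_within_mono) simp
      qed
      then have "M (initial_segment f k) = Some (G (pair i 1))" if "Suc s \<le> k" for k
        using that sub False by (simp add: M_def guess_initial_segment[of f i])
      then show "TxtEx_identifies M f"
        unfolding TxtEx_identifies_def using f W1 by blast
    qed
  qed
qed

theorem theorem3p2: "Sigma0_hard 4 EXL"
  unfolding Sigma0_hard_def
proof (intro allI impI)
  fix P
  assume "Sigma0 4 P"
  then obtain Q where Q: "decidable Q"
    and finite: "\<And>e. P e \<Longrightarrow> finite {i. \<forall>c. \<exists>d. Q (pair e (triple i c d))}"
    and infinite: "\<And>e n. \<not> P e \<Longrightarrow> \<exists>w. \<forall>c. \<exists>d. Q (pair e (triple (pair n w) c d))"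
    by (rule Sigma0_4_finite_form) blast
  define A where "A e i c d \<longleftrightarrow> Q (pair e (triple i c d))" for e i c d
  \<comment> \<open>The column index codes a tag together with a selector: 0 for the full set,
    anything else for the slice.\<close>
  define F where "F e j = (if p2 j = 0 then tagged (p1 j) else slice (A e (p1 j)) (p1 j))" for e j
  define R where "R z \<longleftrightarrow> (let e = p1 (p1 z); j = p1 (p2 (p1 z)); x = p2 (p2 (p1 z)) in
    p1 x = p1 j \<and> (p2 j = 0 \<or> in_slice_within (p2 z) (A e (p1 j)) (p1 j) (p2 x)))" for z
  have slice_dec: "decidable (\<lambda>x. in_slice_within (s x) (A (e x) (i x)) (i x) (v x))"
    if "computable s" "computable e" "computable i" "computable v" for s e i v
    unfolding in_slice_within_def A_def
    by (intro comp_intros decidable_compose[OF Q] that[THEN computable_compose])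
  have "decidable R"
    unfolding R_def[abs_def] Let_def by (intro comp_intros slice_dec)
  have F: "F e j = {x. \<exists>s. R (pair (pair e (pair j x)) s)}" for e j
    by (auto simp: F_def R_def slice_def)
  obtain h where h: "computable h" "\<And>e. W (h e) = {z. \<exists>s. R (pair (pair e z) s)}"
    using smn_ce[OF \<open>decidable R\<close>] by blast
  have column: "column (h e) j = F e j" for e j
    unfolding column_def h F by simp
  have "P e \<longleftrightarrow> h e \<in> EXL" for e
  proof
    assume "P e"
    \<comment> \<open>With \<open>e\<close> fixed, the same relation read in \<open>j\<close> and
      \<open>x\<close> yields indices \<open>G j\<close> of the columns, which serve as the
      learner's conjectures.\<close>
    have "decidable (\<lambda>z. R (pair (pair e (p1 z)) (p2 z)))"
      by (intro comp_intros decidable_compose[OF \<open>decidable R\<close>])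
    then obtain G where G: "computable G" "\<And>j. W (G j) = F e j"
      using smn_ce[of "\<lambda>z. R (pair (pair e (p1 z)) (p2 z))"] by (auto simp: F)
    define B where "B = {i. infinite (slice (A e i) i)}"
    have "B \<subseteq> {i. \<forall>c. \<exists>d. Q (pair e (triple i c d))}"
      using infinite_slice(2)[of "A e i" i for i] unfolding B_def A_def by blast
    then have "finite B"
      using finite[OF \<open>P e\<close>] finite_subset by blast
    let ?M = "\<lambda>l. Some (guess G (A e) B (list_encode l))"
    have "computable (guess G (A e) B)"
      unfolding guess_def[abs_def]
      by (intro comp_intros slice_dec decidable_finite \<open>finite B\<close> computable_compose[OF G(1)])
    then have "learning_machine ?M"
      by (simp add: learning_machine_def computable_def)
    moreover have "TxtEx_learns ?M (F e j)" for j
      using guess_learns[of G "A e" B "p1 j"] by (simp add: G F_def B_def)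
    ultimately have "TxtEx_learnable (uce_family (h e))"
      unfolding TxtEx_learnable_def TxtEx_learns_family_def uce_family_def by (auto simp: column)
    then show "h e \<in> EXL"
      by (simp add: EXL_def)
  next
    assume "h e \<in> EXL"
    then obtain M where M: "learning_machine M" "\<And>j. TxtEx_learns M (F e j)"
      unfolding EXL_def TxtEx_learnable_def TxtEx_learns_family_def uce_family_def
      by (auto simp: column)
    from M(1) obtain p where "eval p = (\<lambda>x. M (list_decode x))"
      unfolding learning_machine_def partial_computable_def by blast
    then have p: "M l = eval p (list_encode l)" for l
      by simp
    show "P e"
    proof (rule ccontr)
      assume "\<not> P e"
      \<comment> \<open>The first component is chosen as the code of the supposed learner, so that
        the slice diagonalizes against that very program.\<close>
      from infinite[OF this] obtain w
        where w: "\<forall>c. \<exists>d. A e (pair (program_code p) w) c d"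
        unfolding A_def by blast
      let ?i = "pair (program_code p) w"
      have "p1 ?i = program_code p"
        by simp
      from not_learns_tagged_and_slice[OF p this w] M(2)[of "pair ?i 0"] M(2)[of "pair ?i 1"]
      show False
        by (simp add: F_def)
    qed
  qed
  with h(1) show "\<exists>h. computable h \<and> (\<forall>e. P e \<longleftrightarrow> h e \<in> EXL)"
    by blast
qed

end
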